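(* Let $k\ge 1$. For $n\ge 1$ let $\mathfrak{m}(k;n)$ be the number of minimal acyclic deterministic finite automata (MADFA) over a fixed alphabet of $k$ symbols whose state set is a fixed set of $n$ labeled states and whose initial state is a fixed element $i$ of that set (the absorbing state $\emptyset$ is not counted). For a non-decreasing function $\chi:\mathbb{N}_+\to\mathbb{N}$ and $n\ge 0$, let $\mathfrak{s}(\chi;n)$ be the number of simple $\chi$-parking functions on a set of $n$ elements. Then $\mathfrak{m}(k;1)=1$ and, for every $n\ge 1$, $$\mathfrak{s}(2m^k-1;\,n)=\sum_{t=1}^{n}\binom{n-1}{t-1}\,\mathfrak{s}\bigl(2(m+t)^k-t-1;\,n-t\bigr)\,\mathfrak{m}(k;t).$$
   Context: Parking functions. $\mathbb{N}_+=\{1,2,\dots\}$. For a non-decreasing $\chi:\mathbb{N}_+\to\mathbb{N}$ and a finite set $N$ with $n$ elements, a $\chi$-parking function on $N$ is a function $f:N\to\mathbb{N}_+$ such that $\#f^{-1}(\{1,\dots,\chi(j)\})\ge j$ for all $j\in\{1,\dots,n\}$ (so $f$ takes values in $\{1,\dots,\chi(n)\}$ when $n\ge 1$). It is simple if every fibre $f^{-1}(\{j\})$ has at most one element. $\mathfrak{s}(\chi;0)=1$. In $\mathfrak{s}(\cdot;n)$ the function $\chi$ is denoted by its value at $m$: for example $\mathfrak{s}(2m^k-1;n)$ means $\chi(m)=2m^k-1$, and in $\mathfrak{s}(2(m+t)^k-t-1;n-t)$ we have $\chi(m)=2(m+t)^k-t-1$, $t$ being fixed. Automata. Let $\Sigma$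 be an alphabet of $k$ symbols. A deterministic finite automaton (DFA) with finite set of states $N$ is a triple $(i,A,\delta)$ with $i\in N$ (initial state), $A\subseteq N$ (accepting states), $\delta:N\times\Sigma\to N\cup\{\emptyset\}$, where $\emptyset\notin N$ is a special non-accepting symbol called the absorbing state, which is not counted as a state. Automata are labeled objects: two automata on $N$ are equal only if they are equal as triples. $\delta$ is extended to words by $\delta^*(q,\epsilon)=q$, $\delta^*(q,aw)=\delta^*(\delta(q,a),w)$, $\delta^*(\emptyset,w)=\emptyset$. The right language of $q\in N$ is $RL(q)=\{w\in\Sigma^*:\delta^*(q,w)\in A\}$. The DFA is: acyclic (an ADFA) if for all $q\in N$, $\delta^*(q,w)=q$ iff $w=\epsilon$; reachable if every $q\in N$ equals $\delta^*(i,w)$ for some $w$; coreachable if for every $q\in N$ there is $w$ with $\delta^*(q,w)\in A$; simple if $RL(q)\ne RL(r)$ for all distinct $q,r\in N$. A DFA is called minimal if it is reachable, coreachable and simple. A MADFA is a minimal ADFA. *)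

theory Defs
  imports Main "HOL-Library.FuncSet"
begin

text \<open>
  The value \<open>\<chi> 0\<close> is never used, so \<open>\<chi> :: nat \<Rightarrow> nat\<close> stands for a
  function on the positive integers.  Functions on a finite set \<open>N\<close> are represented by
  extensional functions, so that each of them is counted once.
\<close>

definition parking_functions :: "(nat \<Rightarrow> nat) \<Rightarrow> 'q set \<Rightarrow> ('q \<Rightarrow> nat) set" where
  "parking_functions \<chi> N =
     {f \<in> N \<rightarrow>\<^sub>E {1..}. \<forall>j\<in>{1..card N}. j \<le> card {x \<in> N. f x \<in> {1..\<chi> j}}}"

definition simple_parking_functions :: "(nat \<Rightarrow> nat) \<Rightarrow> 'q set \<Rightarrow> ('q \<Rightarrow> nat) set" where
  "simple_parking_functions \<chi> N =
     {f \<in> parking_functions \<chi> N. \<forall>j\<ge>1. card {x \<in> N. f x = j} \<le> 1}"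

definition num_simple_parking :: "(nat \<Rightarrow> nat) \<Rightarrow> nat \<Rightarrow> nat" where
  "num_simple_parking \<chi> n = card (simple_parking_functions \<chi> {1..n})"


text \<open>
  A state of \<open>N\<close> is represented by \<open>Some q\<close>, the absorbing state by \<open>None\<close>.
  The transition function is extensional on \<open>N \<times> \<Sigma>\<close>, so that equality of
  triples is equality of automata on \<open>N\<close>.
\<close>

type_synonym ('q, 'a) dfa = "'q \<times> 'q set \<times> ('q \<times> 'a \<Rightarrow> 'q option)"

definition is_dfa :: "'a set \<Rightarrow> 'q set \<Rightarrow> ('q, 'a) dfa \<Rightarrow> bool" where
  "is_dfa \<Sigma> N = (\<lambda>(i, A, \<delta>).
     finite N \<and> i \<in> N \<and> A \<subseteq> N \<and> \<delta> \<in> N \<times> \<Sigma> \<rightarrow>\<^sub>E insert None (Some ` N))"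

primrec delta_star :: "('q \<times> 'a \<Rightarrow> 'q option) \<Rightarrow> 'q option \<Rightarrow> 'a list \<Rightarrow> 'q option" where
  "delta_star \<delta> s [] = s"
| "delta_star \<delta> s (a # w) =
     (case s of None \<Rightarrow> None | Some q \<Rightarrow> delta_star \<delta> (\<delta> (q, a)) w)"

definition right_language :: "'a set \<Rightarrow> ('q, 'a) dfa \<Rightarrow> 'q \<Rightarrow> 'a list set" where
  "right_language \<Sigma> = (\<lambda>(i, A, \<delta>) q.
     {w \<in> lists \<Sigma>. delta_star \<delta> (Some q) w \<in> Some ` A})"

definition dfa_acyclic :: "'a set \<Rightarrow> 'q set \<Rightarrow> ('q, 'a) dfa \<Rightarrow> bool" where
  "dfa_acyclic \<Sigma> N = (\<lambda>(i, A, \<delta>).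
     \<forall>q\<in>N. \<forall>w\<in>lists \<Sigma>. delta_star \<delta> (Some q) w = Some q \<longleftrightarrow> w = [])"

definition dfa_reachable :: "'a set \<Rightarrow> 'q set \<Rightarrow> ('q, 'a) dfa \<Rightarrow> bool" where
  "dfa_reachable \<Sigma> N = (\<lambda>(i, A, \<delta>).
     \<forall>q\<in>N. \<exists>w\<in>lists \<Sigma>. Some q = delta_star \<delta> (Some i) w)"

definition dfa_coreachable :: "'a set \<Rightarrow> 'q set \<Rightarrow> ('q, 'a) dfa \<Rightarrow> bool" where
  "dfa_coreachable \<Sigma> N = (\<lambda>(i, A, \<delta>).
     \<forall>q\<in>N. \<exists>w\<in>lists \<Sigma>. delta_star \<delta> (Some q) w \<in> Some ` A)"

definition dfa_simple :: "'a set \<Rightarrow> 'q set \<Rightarrow> ('q, 'a) dfa \<Rightarrow> bool" where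
  "dfa_simple \<Sigma> N M \<longleftrightarrow>
     (\<forall>q\<in>N. \<forall>r\<in>N. q \<noteq> r \<longrightarrow> right_language \<Sigma> M q \<noteq> right_language \<Sigma> M r)"

definition dfa_minimal :: "'a set \<Rightarrow> 'q set \<Rightarrow> ('q, 'a) dfa \<Rightarrow> bool" where
  "dfa_minimal \<Sigma> N M \<longleftrightarrow> dfa_reachable \<Sigma> N M \<and> dfa_coreachable \<Sigma> N M \<and> dfa_simple \<Sigma> N M"

definition is_madfa :: "'a set \<Rightarrow> 'q set \<Rightarrow> ('q, 'a) dfa \<Rightarrow> bool" where
  "is_madfa \<Sigma> N M \<longleftrightarrow> is_dfa \<Sigma> N M \<and> dfa_acyclic \<Sigma> N M \<and> dfa_minimal \<Sigma> N M"

definition madfas :: "'a set \<Rightarrow> 'q set \<Rightarrow> 'q \<Rightarrow> ('q, 'a) dfa set" where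
  "madfas \<Sigma> N i = {M. is_madfa \<Sigma> N M \<and> fst M = i}"

text \<open>
  Only the sizes of the alphabet and of the state set matter; see \<open>card_madfas\<close> and
  \<open>card_simple_parking_functions\<close> below.
\<close>

definition num_madfa :: "nat \<Rightarrow> nat \<Rightarrow> nat" where
  "num_madfa k n = card (madfas {1..k} {1..n} 1)"


lemma finite_madfas:
  assumes "finite \<Sigma>" "finite N"
  shows "finite (madfas \<Sigma> N i)"
proof (rule finite_subset)
  show "madfas \<Sigma> N i \<subseteq> {i} \<times> Pow N \<times> (N \<times> \<Sigma> \<rightarrow>\<^sub>E insert None (Some ` N))"
    by (auto simp: madfas_def is_madfa_def is_dfa_def)
  show "finite ({i} \<times> Pow N \<times> (N \<times> \<Sigma> \<rightarrow>\<^sub>E insert None (Some ` N)))"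
    using assms by (intro finite_cartesian_product finite_PiE) auto
qed

lemma delta_star_range:
  assumes "\<delta> \<in> N \<times> \<Sigma> \<rightarrow>\<^sub>E insert None (Some ` N)" "w \<in> lists \<Sigma>"
    "s \<in> insert None (Some ` N)"
  shows "delta_star \<delta> s w \<in> insert None (Some ` N)"
  using assms(2,3)
proof (induction w arbitrary: s rule: list.induct)
  case (Cons a w)
  show ?case
  proof (cases s)
    case (Some q)
    then have "\<delta> (q, a) \<in> insert None (Some ` N)"
      using Cons.prems by (intro PiE_mem[OF assms(1)]) auto
    then show ?thesis using Cons Some by simp
  qed simp
qed simp

lemma delta_star_map:
  assumes d: "\<delta> \<in> N \<times> \<Sigma> \<rightarrow>\<^sub>E insert None (Some ` N)"
    and d': "\<And>q a. q \<in> N \<Longrightarrow> a \<in> \<Sigma> \<Longrightarrow> \<delta>' (h q, g a) = map_option h (\<delta> (q, a))"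
    and "w \<in> lists \<Sigma>" "s \<in> insert None (Some ` N)"
  shows "delta_star \<delta>' (map_option h s) (map g w) = map_option h (delta_star \<delta> s w)"
  using assms(3,4)
proof (induction w arbitrary: s rule: list.induct)
  case (Cons a w)
  show ?case
  proof (cases s)
    case (Some q)
    then have "\<delta> (q, a) \<in> insert None (Some ` N)"
      using Cons.prems by (intro PiE_mem[OF d]) auto
    moreover have "\<delta>' (h q, g a) = map_option h (\<delta> (q, a))"
      using Some Cons.prems by (intro d') auto
    ultimately show ?thesis using Cons Some by simp
  qed simp
qed simp

lemma card_madfas_le:
  fixes N :: "'q set" and N' :: "'r set" and \<Sigma> :: "'a set" and \<Sigma>' :: "'b set"
  assumes h: "bij_betw h N N'" and g: "bij_betw g \<Sigma> \<Sigma>'"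
    and fin: "finite N" "finite \<Sigma>" and i: "i \<in> N" "h i = i'"
  shows "card (madfas \<Sigma> N i) \<le> card (madfas \<Sigma>' N' i')"
proof -
  define h' where "h' = inv_into N h"
  define g' where "g' = inv_into \<Sigma> g"
  have hN: "h ` N = N'" "inj_on h N" and g\<Sigma>: "g ` \<Sigma> = \<Sigma>'" "inj_on g \<Sigma>"
    using h g by (auto simp: bij_betw_def)
  have h'h: "h' (h q) = q" if "q \<in> N" for q
    unfolding h'_def using that hN by simp
  have g'g: "g' (g a) = a" if "a \<in> \<Sigma>" for a
    unfolding g'_def using that g\<Sigma> by simp
  define D :: "('q \<times> 'a \<Rightarrow> 'q option) \<Rightarrow> 'r \<times> 'b \<Rightarrow> 'r option"
    where "D \<delta> = (\<lambda>x\<in>N' \<times> \<Sigma>'. map_option h (\<delta> (h' (fst x), g' (snd x))))" for \<delta>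
  define T :: "('q, 'a) dfa \<Rightarrow> ('r, 'b) dfa"
    where "T = (\<lambda>(j, A, \<delta>). (h j, h ` A, D \<delta>))"
  have D: "D \<delta> (h q, g a) = map_option h (\<delta> (q, a))" if "q \<in> N" "a \<in> \<Sigma>" for \<delta> q a
    using that hN g\<Sigma> by (auto simp: D_def h'h g'g)
  have L: "lists \<Sigma>' = map g ` lists \<Sigma>"
    by (simp add: g\<Sigma>(1)[symmetric] lists_image)
  have inj: "inj_on T (madfas \<Sigma> N i)"
  proof (rule inj_onI)
    fix M M' assume M: "M \<in> madfas \<Sigma> N i" "M' \<in> madfas \<Sigma> N i" and eq: "T M = T M'"
    obtain A \<delta> where 1: "M = (i, A, \<delta>)" "A \<subseteq> N"
        "\<delta> \<in> N \<times> \<Sigma> \<rightarrow>\<^sub>E insert None (Some ` N)"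
      using M(1) by (auto simp: madfas_def is_madfa_def is_dfa_def)
    obtain A' \<delta>' where 2: "M' = (i, A', \<delta>')" "A' \<subseteq> N"
        "\<delta>' \<in> N \<times> \<Sigma> \<rightarrow>\<^sub>E insert None (Some ` N)"
      using M(2) by (auto simp: madfas_def is_madfa_def is_dfa_def)
    have "A = A'"
      using eq 1 2 hN by (auto simp: T_def inj_on_image_eq_iff)
    moreover have "\<delta> = \<delta>'"
    proof (rule PiE_ext[OF 1(3) 2(3)])
      fix x assume "x \<in> N \<times> \<Sigma>"
      then obtain q a where x: "x = (q, a)" "q \<in> N" "a \<in> \<Sigma>" by auto
      have m: "\<delta> x \<in> insert None (Some ` N)" "\<delta>' x \<in> insert None (Some ` N)"
        using PiE_mem[OF 1(3)] PiE_mem[OF 2(3)] x by auto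
      have "map_option h (\<delta> x) = map_option h (\<delta>' x)"
        using D[OF x(2,3), of \<delta>] D[OF x(2,3), of \<delta>'] eq 1(1) 2(1) x(1) by (simp add: T_def)
      with m show "\<delta> x = \<delta>' x"
        by (auto simp: inj_on_eq_iff[OF hN(2)])
    qed
    ultimately show "M = M'" using 1 2 by simp
  qed
  have "T M \<in> madfas \<Sigma>' N' i'" if MM: "M \<in> madfas \<Sigma> N i" for M
  proof -
    obtain A \<delta> where M: "M = (i, A, \<delta>)" "A \<subseteq> N"
        "\<delta> \<in> N \<times> \<Sigma> \<rightarrow>\<^sub>E insert None (Some ` N)"
      using MM by (auto simp: madfas_def is_madfa_def is_dfa_def)
    have props: "dfa_acyclic \<Sigma> N (i, A, \<delta>)" "dfa_reachable \<Sigma> N (i, A, \<delta>)"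
        "dfa_coreachable \<Sigma> N (i, A, \<delta>)" "dfa_simple \<Sigma> N (i, A, \<delta>)"
      using MM M(1) by (auto simp: madfas_def is_madfa_def dfa_minimal_def)
    have TM: "T M = (i', h ` A, D \<delta>)"
      using M(1) i by (simp add: T_def)
    have star: "delta_star (D \<delta>) (Some (h q)) (map g w) = map_option h (delta_star \<delta> (Some q) w)"
      if "q \<in> N" "w \<in> lists \<Sigma>" for q w
      using delta_star_map[OF M(3) D that(2), of "Some q"] that(1) by simp
    have ran: "delta_star \<delta> (Some q) w \<in> insert None (Some ` N)"
      if "q \<in> N" "w \<in> lists \<Sigma>" for q w
      using delta_star_range[OF M(3) that(2)] that(1) by simp
    have eq_iff: "delta_star (D \<delta>) (Some (h q)) (map g w) = Some (h r)
        \<longleftrightarrow> delta_star \<delta> (Some q) w = Some r" if "q \<in> N" "r \<in> N" "w \<in> lists \<Sigma>" for q r w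
      using star[OF that(1,3)] ran[OF that(1,3)] that(2) by (auto simp: inj_on_eq_iff[OF hN(2)])
    have acc_iff: "delta_star (D \<delta>) (Some (h q)) (map g w) \<in> Some ` h ` A
        \<longleftrightarrow> delta_star \<delta> (Some q) w \<in> Some ` A" if "q \<in> N" "w \<in> lists \<Sigma>" for q w
      using eq_iff[OF that(1) _ that(2)] M(2)
      by (smt (verit, best) image_iff subsetD)
    have dfa: "is_dfa \<Sigma>' N' (T M)"
    proof -
      have "D \<delta> \<in> N' \<times> \<Sigma>' \<rightarrow>\<^sub>E insert None (Some ` N')"
      proof (rule PiE_I)
        fix x assume "x \<in> N' \<times> \<Sigma>'"
        then obtain q a where x: "x = (h q, g a)" "q \<in> N" "a \<in> \<Sigma>"
          using hN(1) g\<Sigma>(1) by auto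
        have "\<delta> (q, a) \<in> insert None (Some ` N)"
          using x(2,3) by (intro PiE_mem[OF M(3)]) auto
        then show "D \<delta> x \<in> insert None (Some ` N')"
          using D[OF x(2,3)] x(1) hN(1) by auto
      qed (simp add: D_def)
      then show ?thesis
        using TM M(2) i hN(1) fin(1) by (auto simp: is_dfa_def)
    qed
    have ac: "dfa_acyclic \<Sigma>' N' (T M)"
      unfolding TM dfa_acyclic_def L hN(1)[symmetric]
      using props(1) by (auto simp: dfa_acyclic_def eq_iff)
    have re: "dfa_reachable \<Sigma>' N' (T M)"
      unfolding TM dfa_reachable_def L hN(1)[symmetric] i(2)[symmetric]
      using props(2) eq_iff[OF i(1)]
      by (simp add: dfa_reachable_def) (metis (no_types, lifting))
    have co: "dfa_coreachable \<Sigma>' N' (T M)"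
      unfolding TM dfa_coreachable_def L hN(1)[symmetric]
      using props(3) by (simp add: dfa_coreachable_def acc_iff)
    have RL: "right_language \<Sigma>' (T M) (h q) = map g ` right_language \<Sigma> (i, A, \<delta>) q"
      if "q \<in> N" for q
    proof -
      have "{w \<in> map g ` lists \<Sigma>. delta_star (D \<delta>) (Some (h q)) w \<in> Some ` h ` A}
          = map g ` {w \<in> lists \<Sigma>. delta_star (D \<delta>) (Some (h q)) (map g w) \<in> Some ` h ` A}"
        by blast
      also have "\<dots> = map g ` {w \<in> lists \<Sigma>. delta_star \<delta> (Some q) w \<in> Some ` A}"
        using acc_iff[OF that] by (metis (mono_tags, lifting))
      finally show ?thesis
        by (simp only: TM right_language_def L prod.case)
    qed
    have injm: "inj_on (map g) (lists \<Sigma>)"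
      using g\<Sigma>(2) by (simp add: inj_on_map_lists)
    have si: "dfa_simple \<Sigma>' N' (T M)"
      unfolding dfa_simple_def
    proof (intro ballI impI)
      fix q' r' assume "q' \<in> N'" "r' \<in> N'" "q' \<noteq> r'"
      then obtain q r where q: "q' = h q" "r' = h r" "q \<in> N" "r \<in> N" "q \<noteq> r"
        using hN(1) by auto
      then have "right_language \<Sigma> (i, A, \<delta>) q \<noteq> right_language \<Sigma> (i, A, \<delta>) r"
        using props(4) by (auto simp: dfa_simple_def)
      moreover have "right_language \<Sigma> (i, A, \<delta>) s \<subseteq> lists \<Sigma>" for s
        by (auto simp: right_language_def)
      ultimately show "right_language \<Sigma>' (T M) q' \<noteq> right_language \<Sigma>' (T M) r'"
        using q RL inj_on_image_eq_iff[OF injm] by metis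
    qed
    show ?thesis
      using dfa ac re co si TM by (simp add: madfas_def is_madfa_def dfa_minimal_def)
  qed
  then show ?thesis
    using finite_madfas[of \<Sigma>' N' i'] inj fin hN(1) g\<Sigma>(1)
    by (intro card_inj_on_le[of T]) auto
qed

lemma card_madfas:
  assumes "finite \<Sigma>" "finite N" "i \<in> N"
  shows "card (madfas \<Sigma> N i) = num_madfa (card \<Sigma>) (card N)"
proof -
  obtain g where g: "bij_betw g \<Sigma> {1..card \<Sigma>}"
    using assms(1) by (metis bij_betw_iff_card card_atLeastAtMost diff_Suc_1 finite_atLeastAtMost)
  have "card (N - {i}) = card {2..card N}"
    using assms by (simp add: card_Diff_singleton)
  then obtain h0 where h0: "bij_betw h0 (N - {i}) {2..card N}"
    using assms(2) by (metis bij_betw_iff_card finite_Diff finite_atLeastAtMost)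
  have N: "insert i (N - {i}) = N" using assms(3) by auto
  have "card N \<ge> 1" using assms(2,3) by (metis One_nat_def Suc_leI card_gt_0_iff empty_iff)
  then have N': "insert 1 {2..card N} = {1..card N}" by auto
  define h where "h = h0(i := 1)"
  have "bij_betw h (N - {i}) {2..card N}"
    using h0 by (rule bij_betw_cong[THEN iffD1, rotated]) (simp add: h_def)
  then have "bij_betw h (insert i (N - {i})) (insert (h i) {2..card N})"
    by (subst notIn_Un_bij_betw3[of i, simplified, symmetric]) (auto simp: h_def)
  then have "bij_betw h (insert i (N - {i})) (insert 1 {2..card N})"
    by (simp add: h_def)
  then have h: "bij_betw h N {1..card N}" unfolding N N' .
  have hi: "h i = 1" by (simp add: h_def)
  have inv: "inv_into N h 1 = i"
    using h hi assms(3) by (metis bij_betw_inv_into_left)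
  show ?thesis
    unfolding num_madfa_def
    using card_madfas_le[OF h g assms(2,1,3) hi]
      card_madfas_le[OF bij_betw_inv_into[OF h] bij_betw_inv_into[OF g] _ _ _ inv] \<open>card N \<ge> 1\<close>
    by (intro antisym) auto
qed

lemma finite_simple_parking_functions:
  assumes "finite N"
  shows "finite (simple_parking_functions \<chi> N)"
proof (rule finite_subset)
  show "simple_parking_functions \<chi> N \<subseteq> N \<rightarrow>\<^sub>E {1..\<chi> (card N)}"
  proof
    fix f assume f: "f \<in> simple_parking_functions \<chi> N"
    then have f1: "f \<in> N \<rightarrow>\<^sub>E {1..}"
      and f2: "\<forall>j\<in>{1..card N}. j \<le> card {x \<in> N. f x \<in> {1..\<chi> j}}"
      by (auto simp: simple_parking_functions_def parking_functions_def)
    have "f x \<in> {1..\<chi> (card N)}" if x: "x \<in> N" for x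
    proof -
      have "card N \<ge> 1" using assms x by (metis One_nat_def Suc_leI card_gt_0_iff empty_iff)
      then have "card N \<le> card {x \<in> N. f x \<in> {1..\<chi> (card N)}}" using f2 by auto
      then have "{x \<in> N. f x \<in> {1..\<chi> (card N)}} = N"
        using assms by (intro card_seteq) auto
      then show ?thesis using x by blast
    qed
    then show "f \<in> N \<rightarrow>\<^sub>E {1..\<chi> (card N)}" using f1 by (auto simp: PiE_iff)
  qed
  show "finite (N \<rightarrow>\<^sub>E {1..\<chi> (card N)})"
    using assms by (intro finite_PiE) auto
qed

lemma card_simple_parking_functions_le:
  assumes h: "bij_betw h N' N" and fin: "finite N"
  shows "card (simple_parking_functions \<chi> N) \<le> card (simple_parking_functions \<chi> N')"
proof -
  have hN: "h ` N' = N" "inj_on h N'" using h by (auto simp: bij_betw_def)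
  have fin': "finite N'" using h fin bij_betw_finite by blast
  define T where "T f = restrict (f \<circ> h) N'" for f :: "_ \<Rightarrow> nat"
  have card: "card {x \<in> N'. P (T f x)} = card {x \<in> N. P (f x)}" for P f
  proof (rule bij_betw_same_card)
    show "bij_betw h {x \<in> N'. P (T f x)} {x \<in> N. P (f x)}"
      using hN by (auto simp: bij_betw_def T_def intro: inj_on_subset)
  qed
  have inj: "inj_on T (simple_parking_functions \<chi> N)"
  proof (rule inj_onI)
    fix f f' assume f: "f \<in> simple_parking_functions \<chi> N" "f' \<in> simple_parking_functions \<chi> N"
      and eq: "T f = T f'"
    then have f': "f \<in> N \<rightarrow>\<^sub>E {1..}" "f' \<in> N \<rightarrow>\<^sub>E {1..}"
      by (auto simp: simple_parking_functions_def parking_functions_def)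
    show "f = f'"
    proof (rule PiE_ext[OF f'])
      fix x assume "x \<in> N"
      then obtain y where "y \<in> N'" "x = h y" using hN(1) by auto
      then show "f x = f' x" using fun_cong[OF eq, of y] by (simp add: T_def)
    qed
  qed
  have "T f \<in> simple_parking_functions \<chi> N'" if f: "f \<in> simple_parking_functions \<chi> N" for f
  proof -
    have "T f \<in> N' \<rightarrow>\<^sub>E {1..}"
      using f hN(1) by (auto simp: T_def simple_parking_functions_def parking_functions_def PiE_iff)
    moreover have "card N' = card N" using h by (rule bij_betw_same_card)
    ultimately show ?thesis
      using f card[of "\<lambda>y. y \<in> {1..\<chi> _}"] card[of "\<lambda>y. y = _"]
      by (simp add: simple_parking_functions_def parking_functions_def)
  qed
  then show ?thesis
    using inj finite_simple_parking_functions[OF fin'] by (intro card_inj_on_le[of T]) auto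
qed

lemma card_simple_parking_functions:
  assumes "finite N"
  shows "card (simple_parking_functions \<chi> N) = num_simple_parking \<chi> (card N)"
proof -
  obtain h where h: "bij_betw h N {1..card N}"
    using assms by (metis bij_betw_iff_card card_atLeastAtMost diff_Suc_1 finite_atLeastAtMost)
  show ?thesis
    unfolding num_simple_parking_def
    using card_simple_parking_functions_le[OF h]
      card_simple_parking_functions_le[OF bij_betw_inv_into[OF h] assms]
    by (intro antisym) auto
qed

text \<open>
  The two sequences used with \<open>num_simple_parking\<close> are non-decreasing, and no
  natural-number subtraction in them truncates where they are evaluated.
\<close>

lemma mono_on_chi:
  "mono_on {1..} (\<lambda>m::nat. 2 * m ^ k - 1)"
  "mono_on {1..} (\<lambda>m::nat. 2 * (m + t) ^ k - t - 1)"
  by (auto intro!: mono_onI diff_le_mono power_mono)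

lemma int_chi:
  fixes k m t :: nat
  assumes "k \<ge> 1" "m \<ge> 1"
  shows "int (2 * m ^ k - 1) = 2 * int m ^ k - 1"
    and "int (2 * (m + t) ^ k - t - 1) = 2 * (int m + int t) ^ k - int t - 1"
proof -
  have "m ^ k \<ge> 1" using assms(2) by simp
  then show "int (2 * m ^ k - 1) = 2 * int m ^ k - 1" by (simp add: of_nat_diff)
  have "m + t \<le> (m + t) ^ k" using assms by (intro self_le_power) auto
  then have "t + 1 \<le> 2 * (m + t) ^ k" using assms(2) by linarith
  then have "int (2 * (m + t) ^ k - (t + 1)) = int (2 * (m + t) ^ k) - int (t + 1)"
    by (rule of_nat_diff)
  then show "int (2 * (m + t) ^ k - t - 1) = 2 * (int m + int t) ^ k - int t - 1"
    by simp
qed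

end

theory Submission
  imports Defs
begin

text \<open>
  The signature of a state records whether it is accepting and where each letter leads.  In an
  acyclic automaton, distinct states have distinct right languages and none of these is empty
  exactly when the signatures are pairwise distinct and none of them is the signature of the
  absorbing state (\<open>automaton_in_madfas_iff\<close>).  A MADFA is therefore an injective assignment of
  live signatures, with an acyclic transition graph, in which every state is reachable from \<open>i\<close>.
  Both sides of the identity count such assignments on \<open>n\<close> states without the
  reachability condition.

  Right-hand side: the set \<open>T\<close> of states reachable from \<open>i\<close> carries a MADFA, and the other
  \<open>n - t\<close> states carry an acyclic assignment whose letters may also lead into \<open>T\<close>, and which must
  avoid the signature of the absorbing state and the \<open>t\<close> signatures used on \<open>T\<close>
  (\<open>card_structures_with_reachable_set\<close>).  There are \<open>(n - 1) choose (t - 1)\<close> sets \<open>T\<close> of size \<open>t\<close>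
  that contain \<open>i\<close>.

  The link to parking functions: acyclicity says that every nonempty set \<open>U\<close> of states contains a
  state all of whose transitions leave \<open>U\<close>.  A simple \<open>\<chi>\<close>-parking function is an injection \<open>f\<close> such
  that every nonempty \<open>U \<subseteq> N\<close> contains some \<open>x\<close> with \<open>f x \<le> \<chi> (card (N - U) + 1)\<close>.  Both are
  injections \<open>g\<close> for which every nonempty \<open>U \<subseteq> N\<close> contains some \<open>x\<close> with \<open>g x \<in> S (N - U)\<close>, where
  \<open>S\<close> is a monotone family of sets.  The number of such injections depends only on the
  cardinalities of the sets \<open>S V\<close> (\<open>card_grounded_injections_cong\<close>).  With \<open>j - 1\<close> states in \<open>V\<close>
  and \<open>t\<close> states in \<open>T\<close>, a letter has \<open>j + t\<close> possible targets, so that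
  \<open>2 * (j + t) ^ k - t - 1\<close> signatures are available, which is the value \<open>\<chi> j\<close>; the case \<open>T = {}\<close>
  gives the left-hand side.
\<close>

section \<open>Injections grounded in a monotone family of sets\<close>

text \<open>
  The value at \<open>x\<close> may be thought of as depending on a set of points that must come before \<open>x\<close>:
  \<open>S V\<close> holds the values that only depend on points of \<open>V\<close>.  The condition on the sets \<open>U\<close> is
  well-foundedness of this dependency.  For \<open>U = {x}\<close> it also yields \<open>g x \<in> S (R - {x})\<close>, which
  is why no codomain is prescribed.
\<close>

definition grounded_injections :: "('q set \<Rightarrow> 's set) \<Rightarrow> 'q set \<Rightarrow> ('q \<Rightarrow> 's) set" where
  "grounded_injections S R =
     {g \<in> extensional R. inj_on g R \<and> (\<forall>U\<subseteq>R. U \<noteq> {} \<longrightarrow> (\<exists>x\<in>U. g x \<in> S (R - U)))}"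

lemma grounded_injections_mem:
  assumes "g \<in> grounded_injections S R" "x \<in> R"
  shows "g x \<in> S (R - {x})"
proof -
  have "\<forall>U\<subseteq>R. U \<noteq> {} \<longrightarrow> (\<exists>y\<in>U. g y \<in> S (R - U))"
    using assms(1) by (simp add: grounded_injections_def)
  from this[rule_format, of "{x}"] show ?thesis using assms(2) by simp
qed

text \<open>
  The inverse of the pair of restrictions glues functions on \<open>L\<close> and on \<open>R - L\<close>.  The set \<open>B\<close> need
  not be a product: in the decomposition of automata below, what is allowed on \<open>R - L\<close> depends on
  the part on \<open>L\<close>.
\<close>

lemma card_split_domain:
  assumes "L \<subseteq> R" "A \<subseteq> extensional R"
    and "B \<subseteq> extensional L \<times> extensional (R - L)"
    and iff: "\<And>g. g \<in> extensional R \<Longrightarrow> g \<in> A \<longleftrightarrow> (restrict g L, restrict g (R - L)) \<in> B"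
  shows "card A = card B"
proof (rule bij_betw_same_card)
  show "bij_betw (\<lambda>g. (restrict g L, restrict g (R - L))) A B"
    unfolding bij_betw_def
  proof
    show "inj_on (\<lambda>g. (restrict g L, restrict g (R - L))) A"
    proof (rule inj_onI)
      fix f g assume fg: "f \<in> A" "g \<in> A"
        and eq: "(restrict f L, restrict f (R - L)) = (restrict g L, restrict g (R - L))"
      show "f = g"
      proof (rule extensionalityI[of _ R])
        fix x assume "x \<in> R"
        have "restrict f L x = restrict g L x" "restrict f (R - L) x = restrict g (R - L) x"
          using eq by simp_all
        then show "f x = g x" using \<open>x \<in> R\<close> by (cases "x \<in> L") auto
      qed (use fg assms(2) in auto)
    qed
    show "(\<lambda>g. (restrict g L, restrict g (R - L))) ` A = B"
    proof (intro equalityI subsetI)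
      fix p assume "p \<in> B"
      then obtain f g where p: "p = (f, g)" "f \<in> extensional L" "g \<in> extensional (R - L)"
        using assms(3) by auto
      define u where "u = (\<lambda>x. if x \<in> L then f x else g x)"
      have u: "u \<in> extensional R"
        using p(3) assms(1) by (auto simp: u_def extensional_def)
      have "restrict u L = f" "restrict u (R - L) = g"
        using p(2,3) by (auto simp: u_def extensional_def fun_eq_iff)
      then show "p \<in> (\<lambda>g. (restrict g L, restrict g (R - L))) ` A"
        using iff[OF u] \<open>p \<in> B\<close> p(1) by force
    qed (use iff assms(2) in blast)
  qed
qed

lemma inj_on_split:
  assumes "L \<subseteq> R" "inj_on g L" "inj_on g (R - L)" "\<And>x. x \<in> R - L \<Longrightarrow> g x \<notin> g ` L"
  shows "inj_on g R"
proof (rule inj_onI)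
  fix x y assume xy: "x \<in> R" "y \<in> R" "g x = g y"
  then have "x \<in> L \<longleftrightarrow> y \<in> L" using assms(4)[of x] assms(4)[of y] by (metis DiffI imageI)
  then show "x = y" using xy inj_onD[OF assms(2)] inj_onD[OF assms(3)] by blast
qed

lemma card_inj_PiE_cong:
  assumes "finite L" "finite X" "finite Y" "card X = card Y"
  shows "card {f \<in> L \<rightarrow>\<^sub>E X. inj_on f L} = card {f \<in> L \<rightarrow>\<^sub>E Y. inj_on f L}"
  using card_inj_on_subset_funcset[of L X L] card_inj_on_subset_funcset[of L Y L] assms by simp

text \<open>
  Let \<open>L\<close> be the set of points that depend on nothing.  A set \<open>U\<close> that meets \<open>L\<close> imposes no
  condition beyond \<open>g ` L \<subseteq> S {}\<close>, since \<open>S {} \<subseteq> S (R - U)\<close>.  The sets \<open>U \<subseteq> R - L\<close> say that \<open>g\<close> is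
  grounded on \<open>R - L\<close>, where the points of \<open>L\<close> count as settled and the values in \<open>S {}\<close> are
  excluded.  This exclusion makes \<open>L\<close> exactly the first layer and also separates the values on \<open>L\<close>
  from those on \<open>R - L\<close>.
\<close>

lemma card_grounded_injections_first_layer:
  fixes S :: "'q set \<Rightarrow> 's set"
  assumes mono: "\<And>V W. V \<subseteq> W \<Longrightarrow> W \<subseteq> R \<Longrightarrow> S V \<subseteq> S W" and L: "L \<subseteq> R"
  shows "card {g \<in> grounded_injections S R. {x \<in> R. g x \<in> S {}} = L} =
    card {f \<in> L \<rightarrow>\<^sub>E S {}. inj_on f L} *
    card (grounded_injections (\<lambda>V. S (L \<union> V) - S {}) (R - L))"
    (is "card ?A = card ?I * card ?G")
proof -
  have "card ?A = card (?I \<times> ?G)"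
  proof (rule card_split_domain[OF L])
    show "?A \<subseteq> extensional R" "?I \<times> ?G \<subseteq> extensional L \<times> extensional (R - L)"
      by (auto simp: grounded_injections_def PiE_def)
    fix g :: "'q \<Rightarrow> 's" assume g: "g \<in> extensional R"
    show "g \<in> ?A \<longleftrightarrow> (restrict g L, restrict g (R - L)) \<in> ?I \<times> ?G"
    proof
      assume gA: "g \<in> ?A"
      then have inj: "inj_on g R"
        and gr: "\<And>U. U \<subseteq> R \<Longrightarrow> U \<noteq> {} \<Longrightarrow> \<exists>x\<in>U. g x \<in> S (R - U)"
        and lay: "{x \<in> R. g x \<in> S {}} = L"
        by (auto simp: grounded_injections_def)
      have "restrict g L \<in> ?I"
        using inj_on_subset[OF inj L] lay by auto
      moreover have "\<exists>x\<in>U. restrict g (R - L) x \<in> S (L \<union> (R - L - U)) - S {}"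
        if U: "U \<subseteq> R - L" "U \<noteq> {}" for U
      proof -
        obtain x where x: "x \<in> U" "g x \<in> S (R - U)" using gr[of U] U by auto
        moreover have "R - U = L \<union> (R - L - U)" using U L by auto
        ultimately show ?thesis using U lay by (intro bexI[of _ x]) auto
      qed
      then have "restrict g (R - L) \<in> ?G"
        using inj_on_subset[OF inj, of "R - L"] by (auto simp: grounded_injections_def)
      ultimately show "(restrict g L, restrict g (R - L)) \<in> ?I \<times> ?G" by simp
    next
      assume B: "(restrict g L, restrict g (R - L)) \<in> ?I \<times> ?G"
      then have I: "\<And>x. x \<in> L \<Longrightarrow> g x \<in> S {}" "inj_on g L"
        by (auto simp: PiE_iff)
      from B have G: "restrict g (R - L) \<in> ?G" by simp
      then have injG: "inj_on g (R - L)" by (simp add: grounded_injections_def)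
      have notin: "g x \<notin> S {}" if "x \<in> R - L" for x
        using grounded_injections_mem[OF G that] that by simp
      have "g x \<notin> g ` L" if "x \<in> R - L" for x
        using notin[OF that] I(1) by auto
      with L I(2) injG have "inj_on g R" by (rule inj_on_split)
      moreover have "{x \<in> R. g x \<in> S {}} = L" using I notin L by auto
      moreover have "\<exists>x\<in>U. g x \<in> S (R - U)" if U: "U \<subseteq> R" "U \<noteq> {}" for U
      proof (cases "U \<inter> L = {}")
        case True
        then have "U \<subseteq> R - L" using U by auto
        with G U(2) obtain x where "x \<in> U" "restrict g (R - L) x \<in> S (L \<union> (R - L - U))"
          unfolding grounded_injections_def by blast
        moreover have "R - U = L \<union> (R - L - U)" using True L by auto
        ultimately show ?thesis using \<open>U \<subseteq> R - L\<close> by (intro bexI[of _ x]) auto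
      next
        case False
        then show ?thesis using I(1) mono[of "{}" "R - U"] by blast
      qed
      ultimately show "g \<in> ?A" using g by (simp add: grounded_injections_def)
    qed
  qed
  then show ?thesis unfolding card_cartesian_product .
qed

lemma finite_grounded_injections:
  assumes "\<And>V W. V \<subseteq> W \<Longrightarrow> W \<subseteq> R \<Longrightarrow> S V \<subseteq> S W" "finite R" "finite (S R)"
  shows "finite (grounded_injections S R)"
proof (rule finite_subset)
  show "grounded_injections S R \<subseteq> R \<rightarrow>\<^sub>E S R"
  proof
    fix g assume g: "g \<in> grounded_injections S R"
    have "g x \<in> S R" if "x \<in> R" for x
      using grounded_injections_mem[OF g that] assms(1)[of "R - {x}" R] by auto
    then show "g \<in> R \<rightarrow>\<^sub>E S R" using g by (auto simp: grounded_injections_def PiE_def)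
  qed
  show "finite (R \<rightarrow>\<^sub>E S R)" using assms by (intro finite_PiE) auto
qed

lemma card_grounded_injections_sum_layers:
  assumes mono: "\<And>V W. V \<subseteq> W \<Longrightarrow> W \<subseteq> R \<Longrightarrow> S V \<subseteq> S W"
    and fin: "finite R" "finite (S R)" and ne: "R \<noteq> {}"
  shows "card (grounded_injections S R) =
    (\<Sum>L \<in> Pow R - {{}}. card {f \<in> L \<rightarrow>\<^sub>E S {}. inj_on f L} *
      card (grounded_injections (\<lambda>V. S (L \<union> V) - S {}) (R - L)))"
proof -
  have fing: "finite (grounded_injections S R)"
    using mono fin by (rule finite_grounded_injections)
  have nonempty: "{x \<in> R. g x \<in> S {}} \<in> Pow R - {{}}" if "g \<in> grounded_injections S R" for g
  proof -
    have "\<exists>x\<in>R. g x \<in> S (R - R)" using that ne by (auto simp: grounded_injections_def)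
    then show ?thesis by auto
  qed
  have "card (grounded_injections S R) =
      (\<Sum>L \<in> Pow R - {{}}. card {g \<in> grounded_injections S R. {x \<in> R. g x \<in> S {}} = L})"
    unfolding card_eq_sum
    by (rule sum.group[symmetric]) (use fing fin(1) nonempty in blast)+
  also have "\<dots> = (\<Sum>L \<in> Pow R - {{}}. card {f \<in> L \<rightarrow>\<^sub>E S {}. inj_on f L} *
      card (grounded_injections (\<lambda>V. S (L \<union> V) - S {}) (R - L)))"
    by (intro sum.cong refl card_grounded_injections_first_layer mono) auto
  finally show ?thesis .
qed

text \<open>
  Both factors of each summand in the layer decomposition are determined by cardinalities: the
  first by those of \<open>L\<close> and \<open>S {}\<close>, the second by induction, because
  \<open>card (S (L \<union> V) - S {}) = card (S (L \<union> V)) - card (S {})\<close>.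
\<close>

theorem card_grounded_injections_cong:
  fixes S :: "'q set \<Rightarrow> 's set" and S' :: "'q set \<Rightarrow> 'u set"
  assumes "finite R"
    and "\<And>V W. V \<subseteq> W \<Longrightarrow> W \<subseteq> R \<Longrightarrow> S V \<subseteq> S W"
    and "\<And>V W. V \<subseteq> W \<Longrightarrow> W \<subseteq> R \<Longrightarrow> S' V \<subseteq> S' W"
    and "finite (S R)" "finite (S' R)"
    and "\<And>V. V \<subseteq> R \<Longrightarrow> card (S V) = card (S' V)"
  shows "card (grounded_injections S R) = card (grounded_injections S' R)"
  using assms
proof (induction R arbitrary: S S' rule: finite_psubset_induct)
  case (psubset R)
  note mono = psubset.prems(1) and mono' = psubset.prems(2)
  note fin = psubset.prems(3) and fin' = psubset.prems(4) and card = psubset.prems(5)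
  show ?case
  proof (cases "R = {}")
    case True
    then show ?thesis by (simp add: grounded_injections_def)
  next
    case False
    have finS: "finite (S V)" "finite (S' V)" if "V \<subseteq> R" for V
      using that fin fin' mono[of V R] mono'[of V R] by (auto intro: finite_subset)
    have "card {f \<in> L \<rightarrow>\<^sub>E S {}. inj_on f L} *
          card (grounded_injections (\<lambda>V. S (L \<union> V) - S {}) (R - L)) =
        card {f \<in> L \<rightarrow>\<^sub>E S' {}. inj_on f L} *
          card (grounded_injections (\<lambda>V. S' (L \<union> V) - S' {}) (R - L))"
      if L: "L \<in> Pow R - {{}}" for L
    proof (rule arg_cong2[of _ _ _ _ "(*)"])
      show "card {f \<in> L \<rightarrow>\<^sub>E S {}. inj_on f L} = card {f \<in> L \<rightarrow>\<^sub>E S' {}. inj_on f L}"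
        using L psubset.hyps finS[of "{}"] card[of "{}"]
        by (intro card_inj_PiE_cong) (auto intro: finite_subset)
      show "card (grounded_injections (\<lambda>V. S (L \<union> V) - S {}) (R - L)) =
          card (grounded_injections (\<lambda>V. S' (L \<union> V) - S' {}) (R - L))"
      proof (rule psubset.IH)
        show "R - L \<subset> R" using L by auto
        fix V W assume "V \<subseteq> W" "W \<subseteq> R - L"
        then have "L \<union> V \<subseteq> L \<union> W" "L \<union> W \<subseteq> R" using L by auto
        then have "S (L \<union> V) \<subseteq> S (L \<union> W)" "S' (L \<union> V) \<subseteq> S' (L \<union> W)"
          by (rule mono, rule mono')
        then show "S (L \<union> V) - S {} \<subseteq> S (L \<union> W) - S {}"
          and "S' (L \<union> V) - S' {} \<subseteq> S' (L \<union> W) - S' {}"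
          by (simp_all add: Diff_mono)
      next
        have "L \<union> (R - L) = R" using L by auto
        then show "finite (S (L \<union> (R - L)) - S {})" "finite (S' (L \<union> (R - L)) - S' {})"
          using fin fin' by auto
      next
        fix V assume "V \<subseteq> R - L"
        then have sub: "L \<union> V \<subseteq> R" using L by auto
        show "card (S (L \<union> V) - S {}) = card (S' (L \<union> V) - S' {})"
          using mono[OF _ sub, of "{}"] mono'[OF _ sub, of "{}"] finS[of "{}"]
            card[OF sub] card[of "{}"]
          by (simp add: card_Diff_subset)
      qed
    qed
    then show ?thesis
      by (simp add: card_grounded_injections_sum_layers[of R S, OF mono psubset.hyps fin False]
          card_grounded_injections_sum_layers[of R S', OF mono' psubset.hyps fin' False])
  qed
qed

section \<open>Parking functions\<close>

text \<open>
  At least \<open>j\<close> points have a value \<open>\<le> \<chi> j\<close> if and only if these points meet every set of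
  \<open>card N - j + 1\<close> points; such a set has a complement with \<open>j - 1\<close> points.
\<close>

lemma simple_parking_functions_eq_grounded_injections:
  assumes mono: "mono_on {1..} \<chi>" and fin: "finite N"
  shows "simple_parking_functions \<chi> N = grounded_injections (\<lambda>V. {1..\<chi> (card V + 1)}) N"
    (is "_ = grounded_injections ?S N")
proof (intro equalityI subsetI)
  fix f assume "f \<in> simple_parking_functions \<chi> N"
  then have f: "f \<in> N \<rightarrow>\<^sub>E {1..}"
    and park: "\<And>j. j \<in> {1..card N} \<Longrightarrow> j \<le> card {x \<in> N. f x \<in> {1..\<chi> j}}"
    and simp: "\<And>j. j \<ge> 1 \<Longrightarrow> card {x \<in> N. f x = j} \<le> 1"
    by (auto simp: simple_parking_functions_def parking_functions_def)
  have "inj_on f N"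
  proof (rule inj_onI)
    fix x y assume xy: "x \<in> N" "y \<in> N" "f x = f y"
    have "f x \<ge> 1" using f xy(1) by (auto simp: PiE_iff)
    from simp[OF this] show "x = y"
      using xy fin by (auto simp: card_le_Suc0_iff_eq)
  qed
  moreover have "\<exists>x\<in>U. f x \<in> ?S (N - U)" if U: "U \<subseteq> N" "U \<noteq> {}" for U
  proof (rule ccontr)
    assume none: "\<not> (\<exists>x\<in>U. f x \<in> ?S (N - U))"
    have "card U \<ge> 1" "card U \<le> card N" "card (N - U) = card N - card U"
      using U fin finite_subset[OF U(1)]
      by (auto simp: card_mono card_Diff_subset Suc_le_eq card_gt_0_iff)
    then have "card (N - U) + 1 \<le> card {x \<in> N. f x \<in> ?S (N - U)}"
      by (intro park) auto
    also have "\<dots> \<le> card (N - U)"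
      using none U fin by (intro card_mono) auto
    finally show False by simp
  qed
  ultimately show "f \<in> grounded_injections ?S N"
    using f by (simp add: grounded_injections_def PiE_def)
next
  fix f assume f: "f \<in> grounded_injections ?S N"
  then have inj: "inj_on f N" and ext: "f \<in> extensional N"
    and gr: "\<And>U. U \<subseteq> N \<Longrightarrow> U \<noteq> {} \<Longrightarrow> \<exists>x\<in>U. f x \<in> ?S (N - U)"
    by (auto simp: grounded_injections_def)
  have "f \<in> N \<rightarrow>\<^sub>E {1..}"
    using grounded_injections_mem[OF f] ext by (auto simp: PiE_def)
  moreover have "j \<le> card {x \<in> N. f x \<in> {1..\<chi> j}}" if j: "j \<in> {1..card N}" for j
  proof (rule ccontr)
    \<comment> \<open>If too few points have a value \<open>\<le> \<chi> j\<close>, then the set of all other points violates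
      groundedness.\<close>
    define P where "P = {x \<in> N. f x \<in> {1..\<chi> j}}"
    assume "\<not> j \<le> card {x \<in> N. f x \<in> {1..\<chi> j}}"
    then have P: "card P < j" "P \<subseteq> N" by (auto simp: P_def)
    then have "N - P \<noteq> {}" using j by auto
    then obtain x where x: "x \<in> N - P" "f x \<in> ?S (N - (N - P))"
      using gr[of "N - P"] by blast
    have "N - (N - P) = P" using P(2) by auto
    moreover have "\<chi> (card P + 1) \<le> \<chi> j"
      using P(1) by (intro mono_onD[OF mono]) auto
    ultimately have "x \<in> P" using x by (auto simp: P_def)
    with x(1) show False by simp
  qed
  moreover have "card {x \<in> N. f x = j} \<le> 1" for j
    using inj fin by (auto simp: card_le_Suc0_iff_eq inj_on_def)
  ultimately show "f \<in> simple_parking_functions \<chi> N"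
    by (simp add: simple_parking_functions_def parking_functions_def)
qed

section \<open>Signatures of states\<close>

type_synonym ('q, 'a) signature = "bool \<times> ('a \<Rightarrow> 'q option)"

definition signatures :: "'a set \<Rightarrow> 'q set \<Rightarrow> ('q, 'a) signature set" where
  "signatures \<Sigma> V = UNIV \<times> (\<Sigma> \<rightarrow>\<^sub>E insert None (Some ` V))"

definition dead :: "'a set \<Rightarrow> ('q, 'a) signature" where
  "dead \<Sigma> = (False, \<lambda>a\<in>\<Sigma>. None)"

lemma finite_signatures:
  assumes "finite \<Sigma>" "finite V"
  shows "finite (signatures \<Sigma> V)"
  unfolding signatures_def using assms by (intro finite_cartesian_product finite_PiE) auto

lemma card_signatures:
  assumes "finite \<Sigma>" "finite V"
  shows "card (signatures \<Sigma> V) = 2 * (card V + 1) ^ card \<Sigma>"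
  using assms unfolding signatures_def
  by (simp add: card_cartesian_product card_PiE card_image)

lemma signatures_mono: "V \<subseteq> W \<Longrightarrow> signatures \<Sigma> V \<subseteq> signatures \<Sigma> W"
  unfolding signatures_def by (intro Sigma_mono PiE_mono) auto

lemma dead_in_signatures: "dead \<Sigma> \<in> signatures \<Sigma> V"
  by (auto simp: dead_def signatures_def)

text \<open>
  The states in \<open>T\<close> are settled in advance, and \<open>F\<close> consists of the \<open>t + 1\<close> signatures that are
  already taken, by the absorbing state and by the states of \<open>T\<close>.
\<close>

lemma card_grounded_signatures:
  fixes R T :: "'q set" and \<Sigma> :: "'a set"
  assumes fin: "finite \<Sigma>" "finite R" "finite T" and dis: "R \<inter> T = {}"
    and F: "F \<subseteq> signatures \<Sigma> T" "card F = t + 1" and t: "t = card T"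
  shows "card (grounded_injections (\<lambda>V. signatures \<Sigma> (T \<union> V) - F) R) =
    num_simple_parking (\<lambda>m. 2 * (m + t) ^ card \<Sigma> - t - 1) (card R)"
proof -
  let ?\<chi> = "\<lambda>m. 2 * (m + t) ^ card \<Sigma> - t - 1"
  have "card (grounded_injections (\<lambda>V. signatures \<Sigma> (T \<union> V) - F) R) =
      card (grounded_injections (\<lambda>V. {1..?\<chi> (card V + 1)}) R)"
  proof (rule card_grounded_injections_cong)
    show "signatures \<Sigma> (T \<union> V) - F \<subseteq> signatures \<Sigma> (T \<union> W) - F" if "V \<subseteq> W" for V W
      using signatures_mono[of "T \<union> V" "T \<union> W" \<Sigma>] that by blast
    show "{1..?\<chi> (card V + 1)} \<subseteq> {1..?\<chi> (card W + 1)}" if "V \<subseteq> W" "W \<subseteq> R" for V W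
    proof -
      have "card V \<le> card W" using that fin by (meson card_mono finite_subset)
      then have "?\<chi> (card V + 1) \<le> ?\<chi> (card W + 1)"
        by (intro mono_onD[OF mono_on_chi(2)]) auto
      then show ?thesis by simp
    qed
    show "card (signatures \<Sigma> (T \<union> V) - F) = card {1..?\<chi> (card V + 1)}" if "V \<subseteq> R" for V
    proof -
      have finV: "finite V" using that fin finite_subset by auto
      have "F \<subseteq> signatures \<Sigma> (T \<union> V)" using F(1) signatures_mono[of T "T \<union> V" \<Sigma>] by auto
      moreover have "finite F" using F(1) fin finite_signatures finite_subset by metis
      moreover have "card (T \<union> V) = t + card V"
        using t finV fin that dis by (subst card_Un_disjoint) auto
      ultimately show ?thesis
        using fin finV F(2) by (simp add: card_Diff_subset card_signatures algebra_simps)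
    qed
  qed (use fin in \<open>auto intro: finite_signatures\<close>)
  also have "\<dots> = card (simple_parking_functions ?\<chi> R)"
    using simple_parking_functions_eq_grounded_injections[OF mono_on_chi(2) fin(2)] by simp
  finally show ?thesis using card_simple_parking_functions[OF fin(2)] by simp
qed

section \<open>Splitting an acyclic structure along its reachable part\<close>

definition edges :: "'a set \<Rightarrow> 'q set \<Rightarrow> ('q \<Rightarrow> ('q, 'a) signature) \<Rightarrow> 'q rel" where
  "edges \<Sigma> N g = {(q, r). q \<in> N \<and> (\<exists>a\<in>\<Sigma>. snd (g q) a = Some r)}"

text \<open>
  These assignments correspond to the automata on \<open>N\<close> that are acyclic, coreachable and simple; for
  the rooted ones, all states are moreover reachable from \<open>i\<close>.
\<close>

definition acyclic_structures :: "'a set \<Rightarrow> 'q set \<Rightarrow> ('q \<Rightarrow> ('q, 'a) signature) set" where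
  "acyclic_structures \<Sigma> N = grounded_injections (\<lambda>V. signatures \<Sigma> V - {dead \<Sigma>}) N"

definition rooted_structures :: "'a set \<Rightarrow> 'q set \<Rightarrow> 'q \<Rightarrow> ('q \<Rightarrow> ('q, 'a) signature) set" where
  "rooted_structures \<Sigma> N i = {g \<in> acyclic_structures \<Sigma> N. (edges \<Sigma> N g)\<^sup>* `` {i} = N}"

lemma signature_in_signatures_iff:
  assumes "g q \<in> signatures \<Sigma> N" "q \<in> N" "V \<subseteq> N"
  shows "g q \<in> signatures \<Sigma> V \<longleftrightarrow> edges \<Sigma> N g `` {q} \<subseteq> V"
proof -
  obtain b d where gq: "g q = (b, d)" by (cases "g q")
  then have "d \<in> \<Sigma> \<rightarrow>\<^sub>E insert None (Some ` N)" using assms(1) by (simp add: signatures_def)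
  then have "d \<in> extensional \<Sigma>" by (simp add: PiE_iff)
  moreover have "x \<in> insert None (Some ` V) \<longleftrightarrow> (\<forall>r. x = Some r \<longrightarrow> r \<in> V)" for x
    by (cases x) auto
  ultimately show ?thesis
    using gq assms(2) by (auto simp: signatures_def edges_def PiE_iff)
qed

lemma acyclic_structuresD:
  assumes "g \<in> acyclic_structures \<Sigma> N" "q \<in> N"
  shows "g q \<in> signatures \<Sigma> N" "g q \<noteq> dead \<Sigma>"
  using grounded_injections_mem[OF assms[unfolded acyclic_structures_def]]
    signatures_mono[of "N - {q}" N \<Sigma>] by auto

lemma edges_into:
  assumes "\<And>q. q \<in> N \<Longrightarrow> g q \<in> signatures \<Sigma> N"
  shows "edges \<Sigma> N g `` X \<subseteq> N"
  using assms by (fastforce simp: edges_def signatures_def PiE_iff)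

lemma reachable_subset:
  assumes "E `` X \<subseteq> X" "i \<in> X"
  shows "E\<^sup>* `` {i} \<subseteq> X"
  using assms Image_closed_trancl[OF assms(1)] by blast

text \<open>
  No transition leaves the reachable set \<open>T\<close>, so the restriction of \<open>g\<close> to \<open>T\<close> is an acyclic
  structure on \<open>T\<close> by itself, while the states outside \<open>T\<close> see \<open>T\<close> only as a set of further targets
  and of signatures that injectivity forbids.  Conversely, glued parts are acyclic because a
  cycle lies either in \<open>T\<close> or outside \<open>T\<close>, and transitions outside \<open>T\<close> do not change what is reachable from \<open>i \<in> T\<close>.
\<close>

lemma card_structures_with_reachable_set:
  fixes N :: "'q set" and \<Sigma> :: "'a set"
  assumes T: "T \<subseteq> N" "i \<in> T"
  shows "card {g \<in> acyclic_structures \<Sigma> N. (edges \<Sigma> N g)\<^sup>* `` {i} = T} =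
    card (SIGMA h : rooted_structures \<Sigma> T i.
      grounded_injections (\<lambda>V. signatures \<Sigma> (T \<union> V) - insert (dead \<Sigma>) (h ` T)) (N - T))"
    (is "card ?A = card ?B")
proof (rule card_split_domain[OF T(1)])
  show "?A \<subseteq> extensional N" "?B \<subseteq> extensional T \<times> extensional (N - T)"
    by (auto simp: acyclic_structures_def rooted_structures_def grounded_injections_def)
  fix g :: "'q \<Rightarrow> ('q, 'a) signature" assume ext: "g \<in> extensional N"
  let ?h = "restrict g T" and ?g' = "restrict g (N - T)"
  have im: "?h ` T = g ` T" by auto
  have edges_h: "edges \<Sigma> T ?h = edges \<Sigma> N g \<inter> T \<times> UNIV"
    using T(1) by (auto simp: edges_def)
  show "g \<in> ?A \<longleftrightarrow> (?h, ?g') \<in> ?B"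
  proof
    assume gA: "g \<in> ?A"
    then have gW: "g \<in> acyclic_structures \<Sigma> N" and reach: "(edges \<Sigma> N g)\<^sup>* `` {i} = T" by auto
    have inj: "inj_on g N"
      and gr: "\<And>U. U \<subseteq> N \<Longrightarrow> U \<noteq> {} \<Longrightarrow> \<exists>x\<in>U. g x \<in> signatures \<Sigma> (N - U) - {dead \<Sigma>}"
      using gW by (auto simp: acyclic_structures_def grounded_injections_def)
    have closed: "edges \<Sigma> N g `` T \<subseteq> T"
      unfolding reach[symmetric] by (auto intro: rtrancl_into_rtrancl)
    have "\<exists>x\<in>U. ?h x \<in> signatures \<Sigma> (T - U) - {dead \<Sigma>}" if U: "U \<subseteq> T" "U \<noteq> {}" for U
    proof -
      obtain x where x: "x \<in> U" "g x \<in> signatures \<Sigma> (N - U)" "g x \<noteq> dead \<Sigma>"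
        using gr[of U] U T(1) by blast
      have xN: "x \<in> N" "g x \<in> signatures \<Sigma> N"
        using x U T(1) acyclic_structuresD[OF gW] by auto
      have "edges \<Sigma> N g `` {x} \<subseteq> N - U"
        using signature_in_signatures_iff[of g x, OF xN(2,1), of "N - U"] x(2) by auto
      then have "edges \<Sigma> N g `` {x} \<subseteq> T - U" using closed x(1) U(1) by blast
      then have "g x \<in> signatures \<Sigma> (T - U)"
        using signature_in_signatures_iff[of g x, OF xN(2,1), of "T - U"] T(1) by auto
      then show ?thesis using x U by (intro bexI[of _ x]) auto
    qed
    then have h: "?h \<in> acyclic_structures \<Sigma> T"
      using inj_on_subset[OF inj T(1)] by (auto simp: acyclic_structures_def grounded_injections_def)
    have "(edges \<Sigma> T ?h)\<^sup>* `` {i} = T"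
    proof
      show "(edges \<Sigma> T ?h)\<^sup>* `` {i} \<subseteq> T"
        using closed T(2) by (intro reachable_subset) (auto simp: edges_h)
      have "(edges \<Sigma> N g)\<^sup>* `` {i} \<subseteq> (edges \<Sigma> T ?h)\<^sup>* `` {i}"
      proof (intro reachable_subset subsetI)
        fix r assume "r \<in> edges \<Sigma> N g `` ((edges \<Sigma> T ?h)\<^sup>* `` {i})"
        then obtain q where q: "(i, q) \<in> (edges \<Sigma> T ?h)\<^sup>*" "(q, r) \<in> edges \<Sigma> N g" by auto
        moreover have "q \<in> T" using q(1) \<open>(edges \<Sigma> T ?h)\<^sup>* `` {i} \<subseteq> T\<close> by auto
        ultimately have "(q, r) \<in> edges \<Sigma> T ?h" by (simp add: edges_h)
        then show "r \<in> (edges \<Sigma> T ?h)\<^sup>* `` {i}" using q(1) by (auto intro: rtrancl_into_rtrancl)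
      qed simp
      then show "T \<subseteq> (edges \<Sigma> T ?h)\<^sup>* `` {i}" by (simp add: reach)
    qed
    with h have "?h \<in> rooted_structures \<Sigma> T i" by (simp add: rooted_structures_def)
    moreover have "\<exists>x\<in>U. ?g' x \<in> signatures \<Sigma> (T \<union> (N - T - U)) - insert (dead \<Sigma>) (?h ` T)"
      if U: "U \<subseteq> N - T" "U \<noteq> {}" for U
    proof -
      obtain x where x: "x \<in> U" "g x \<in> signatures \<Sigma> (N - U)" "g x \<noteq> dead \<Sigma>"
        using gr[of U] U by blast
      moreover have "N - U = T \<union> (N - T - U)" using U T by auto
      moreover have "g x \<notin> g ` T" using inj x(1) U T(1) by (auto simp: inj_on_def)
      ultimately show ?thesis using U by (intro bexI[of _ x]) (auto simp: im)
    qed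
    then have "?g' \<in> grounded_injections
        (\<lambda>V. signatures \<Sigma> (T \<union> V) - insert (dead \<Sigma>) (?h ` T)) (N - T)"
      using inj_on_subset[OF inj, of "N - T"] by (auto simp: grounded_injections_def)
    ultimately show "(?h, ?g') \<in> ?B" by simp
  next
    assume "(?h, ?g') \<in> ?B"
    then have hR: "?h \<in> rooted_structures \<Sigma> T i"
      and g': "?g' \<in> grounded_injections
          (\<lambda>V. signatures \<Sigma> (T \<union> V) - insert (dead \<Sigma>) (?h ` T)) (N - T)" by auto
    have h: "?h \<in> acyclic_structures \<Sigma> T" and reach: "(edges \<Sigma> T ?h)\<^sup>* `` {i} = T"
      using hR by (auto simp: rooted_structures_def)
    have "inj_on g T" using h by (auto simp: acyclic_structures_def grounded_injections_def)
    moreover have "inj_on g (N - T)" using g' by (auto simp: grounded_injections_def)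
    moreover have "g x \<notin> g ` T" if "x \<in> N - T" for x
      using grounded_injections_mem[OF g' that] that by (auto simp: im)
    ultimately have "inj_on g N" by (rule inj_on_split[OF T(1)])
    moreover have "\<exists>x\<in>U. g x \<in> signatures \<Sigma> (N - U) - {dead \<Sigma>}"
      if U: "U \<subseteq> N" "U \<noteq> {}" for U
    proof (cases "U \<inter> T = {}")
      case True
      then have UT: "U \<subseteq> N - T" using U by auto
      with g' U(2) obtain x
        where x: "x \<in> U" "?g' x \<in> signatures \<Sigma> (T \<union> (N - T - U)) - insert (dead \<Sigma>) (?h ` T)"
        unfolding grounded_injections_def by blast
      moreover have "N - U = T \<union> (N - T - U)" using True T by auto
      ultimately show ?thesis using UT by (intro bexI[of _ x]) auto
    next
      case False
      moreover have "\<forall>U\<subseteq>T. U \<noteq> {} \<longrightarrow> (\<exists>x\<in>U. ?h x \<in> signatures \<Sigma> (T - U) - {dead \<Sigma>})"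
        using h by (simp add: acyclic_structures_def grounded_injections_def)
      ultimately obtain x
        where x: "x \<in> U \<inter> T" "?h x \<in> signatures \<Sigma> (T - U \<inter> T) - {dead \<Sigma>}"
        by (meson Int_lower2)
      moreover have "T - U \<inter> T \<subseteq> N - U" using T(1) by auto
      ultimately show ?thesis
        using signatures_mono[of "T - U \<inter> T" "N - U" \<Sigma>] by (intro bexI[of _ x]) auto
    qed
    ultimately have gW: "g \<in> acyclic_structures \<Sigma> N"
      using ext by (simp add: acyclic_structures_def grounded_injections_def)
    have "edges \<Sigma> T ?h `` T \<subseteq> T"
      using acyclic_structuresD(1)[OF h] by (rule edges_into)
    then have "edges \<Sigma> N g `` T \<subseteq> T" by (auto simp: edges_h)
    then have "(edges \<Sigma> N g)\<^sup>* `` {i} \<subseteq> T" using T(2) by (rule reachable_subset)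
    moreover have "(edges \<Sigma> T ?h)\<^sup>* \<subseteq> (edges \<Sigma> N g)\<^sup>*"
      by (rule rtrancl_mono) (auto simp: edges_h)
    ultimately have "(edges \<Sigma> N g)\<^sup>* `` {i} = T" using reach by blast
    with gW show "g \<in> ?A" by simp
  qed
qed


section \<open>Minimal acyclic automata as rooted structures\<close>

definition transition :: "'a set \<Rightarrow> 'q set \<Rightarrow> ('q \<Rightarrow> ('q, 'a) signature) \<Rightarrow> 'q \<times> 'a \<Rightarrow> 'q option" where
  "transition \<Sigma> N g = (\<lambda>(q, a)\<in>N \<times> \<Sigma>. snd (g q) a)"

lemma transition_apply [simp]: "\<lbrakk>q \<in> N; a \<in> \<Sigma>\<rbrakk> \<Longrightarrow> transition \<Sigma> N g (q, a) = snd (g q) a"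
  by (simp add: transition_def)

definition automaton :: "'a set \<Rightarrow> 'q set \<Rightarrow> 'q \<Rightarrow> ('q \<Rightarrow> ('q, 'a) signature) \<Rightarrow> ('q, 'a) dfa" where
  "automaton \<Sigma> N i g = (i, {q \<in> N. fst (g q)}, transition \<Sigma> N g)"

lemma delta_star_None [simp]: "delta_star \<delta> None w = None"
  by (cases w) auto

text \<open>
  An assignment of signatures without any condition of acyclicity or injectivity, that is, an
  arbitrary automaton on \<open>N\<close> with initial state \<open>i\<close>.
\<close>

locale signature_assignment =
  fixes \<Sigma> :: "'a set" and N :: "'q set" and i :: 'q and g :: "'q \<Rightarrow> ('q, 'a) signature"
  assumes g: "g \<in> N \<rightarrow>\<^sub>E signatures \<Sigma> N" and fin: "finite N" and i: "i \<in> N"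
begin

abbreviation "E \<equiv> edges \<Sigma> N g"
abbreviation "\<delta> \<equiv> transition \<Sigma> N g"
abbreviation "RL \<equiv> right_language \<Sigma> (automaton \<Sigma> N i g)"

lemma signature: "q \<in> N \<Longrightarrow> g q \<in> signatures \<Sigma> N"
  using g by (rule PiE_mem)

lemma target_in_states: "\<lbrakk>q \<in> N; a \<in> \<Sigma>; snd (g q) a = Some r\<rbrakk> \<Longrightarrow> r \<in> N"
  using signature[of q] by (fastforce simp: signatures_def PiE_iff)

lemma edgeI: "\<lbrakk>q \<in> N; a \<in> \<Sigma>; snd (g q) a = Some r\<rbrakk> \<Longrightarrow> (q, r) \<in> E"
  by (auto simp: edges_def)

lemma edges_subset: "E \<subseteq> N \<times> N"
  using target_in_states by (auto simp: edges_def)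

lemma delta_star_imp_trancl:
  assumes "w \<in> lists \<Sigma>" "q \<in> N" "delta_star \<delta> (Some q) w = Some r" "w \<noteq> []"
  shows "(q, r) \<in> E\<^sup>+"
  using assms
proof (induction w arbitrary: q rule: list.induct)
  case (Cons a w)
  then have a: "a \<in> \<Sigma>" and w: "w \<in> lists \<Sigma>" by auto
  have step: "delta_star \<delta> (snd (g q) a) w = Some r" using Cons.prems a by simp
  then obtain s where s: "snd (g q) a = Some s" by (cases "snd (g q) a") auto
  have e: "(q, s) \<in> E" "s \<in> N" using edgeI target_in_states Cons.prems(2) a s by auto
  show ?case
  proof (cases "w = []")
    case True
    then show ?thesis using step s e(1) by auto
  next
    case False
    then have "(s, r) \<in> E\<^sup>+" using Cons.IH[OF w e(2)] step s by simp
    then show ?thesis using e(1) by (rule trancl_into_trancl2[rotated])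
  qed
qed simp

lemma rtrancl_imp_delta_star:
  assumes "(q, r) \<in> E\<^sup>*"
  shows "\<exists>w\<in>lists \<Sigma>. delta_star \<delta> (Some q) w = Some r"
  using assms
proof (induction rule: converse_rtrancl_induct)
  case base
  show ?case by (intro bexI[of _ "[]"]) auto
next
  case (step q s)
  then obtain a w where "q \<in> N" "a \<in> \<Sigma>" "snd (g q) a = Some s"
    "w \<in> lists \<Sigma>" "delta_star \<delta> (Some s) w = Some r"
    by (auto simp: edges_def)
  then show ?case by (intro bexI[of _ "a # w"]) auto
qed

lemma dfa_acyclic_iff: "dfa_acyclic \<Sigma> N (automaton \<Sigma> N i g) \<longleftrightarrow> acyclic E"
proof
  assume ac: "dfa_acyclic \<Sigma> N (automaton \<Sigma> N i g)"
  show "acyclic E"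
    unfolding acyclic_def
  proof (intro allI notI)
    fix q assume "(q, q) \<in> E\<^sup>+"
    then obtain s where s: "(q, s) \<in> E" "(s, q) \<in> E\<^sup>*" by (meson tranclD)
    then obtain a w where aw: "q \<in> N" "a \<in> \<Sigma>" "snd (g q) a = Some s"
      "w \<in> lists \<Sigma>" "delta_star \<delta> (Some s) w = Some q"
      using rtrancl_imp_delta_star[OF s(2)] by (auto simp: edges_def)
    then have "delta_star \<delta> (Some q) (a # w) = Some q" "a # w \<in> lists \<Sigma>" by auto
    then show False
      using ac aw(1) unfolding dfa_acyclic_def automaton_def by blast
  qed
next
  assume "acyclic E"
  then show "dfa_acyclic \<Sigma> N (automaton \<Sigma> N i g)"
    using delta_star_imp_trancl unfolding dfa_acyclic_def automaton_def acyclic_def by fastforce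
qed

lemma dfa_reachable_iff: "dfa_reachable \<Sigma> N (automaton \<Sigma> N i g) \<longleftrightarrow> E\<^sup>* `` {i} = N"
proof -
  have "(\<exists>w\<in>lists \<Sigma>. Some q = delta_star \<delta> (Some i) w) \<longleftrightarrow> (i, q) \<in> E\<^sup>*" for q
  proof
    assume "\<exists>w\<in>lists \<Sigma>. Some q = delta_star \<delta> (Some i) w"
    then obtain w where w: "w \<in> lists \<Sigma>" "delta_star \<delta> (Some i) w = Some q" by metis
    show "(i, q) \<in> E\<^sup>*"
    proof (cases "w = []")
      case False
      then show ?thesis using delta_star_imp_trancl[OF w(1) i w(2)] by (simp add: trancl_into_rtrancl)
    qed (use w in simp)
  next
    assume "(i, q) \<in> E\<^sup>*"
    from rtrancl_imp_delta_star[OF this]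
    show "\<exists>w\<in>lists \<Sigma>. Some q = delta_star \<delta> (Some i) w" by metis
  qed
  then have "dfa_reachable \<Sigma> N (automaton \<Sigma> N i g) \<longleftrightarrow> N \<subseteq> E\<^sup>* `` {i}"
    unfolding dfa_reachable_def automaton_def by auto
  moreover have "E\<^sup>* `` {i} \<subseteq> N"
    using edges_subset i by (intro reachable_subset) auto
  ultimately show ?thesis by auto
qed

lemma Nil_in_RL: "q \<in> N \<Longrightarrow> [] \<in> RL q \<longleftrightarrow> fst (g q)"
  by (auto simp: right_language_def automaton_def)

lemma Cons_in_RL:
  "q \<in> N \<Longrightarrow> a # w \<in> RL q \<longleftrightarrow> a \<in> \<Sigma> \<and> (\<exists>r. snd (g q) a = Some r \<and> w \<in> RL r)"
  by (cases "snd (g q) a") (auto simp: right_language_def automaton_def)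

lemma dfa_coreachable_iff: "dfa_coreachable \<Sigma> N (automaton \<Sigma> N i g) \<longleftrightarrow> (\<forall>q\<in>N. RL q \<noteq> {})"
  unfolding dfa_coreachable_def right_language_def automaton_def prod.case by blast

lemma signature_eqI:
  assumes "q \<in> N" "f \<in> signatures \<Sigma> N" "fst (g q) = fst f"
    and "\<And>a. a \<in> \<Sigma> \<Longrightarrow> snd (g q) a = snd f a"
  shows "g q = f"
proof (rule prod_eqI)
  have "snd (g q) \<in> \<Sigma> \<rightarrow>\<^sub>E insert None (Some ` N)" "snd f \<in> \<Sigma> \<rightarrow>\<^sub>E insert None (Some ` N)"
    using signature[OF assms(1)] assms(2) by (auto simp: signatures_def)
  then show "snd (g q) = snd f" using assms(4) by (rule PiE_ext)
qed (rule assms(3))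

lemma RL_cong:
  assumes "q \<in> N" "r \<in> N" "g q = g r"
  shows "RL q = RL r"
proof (rule set_eqI)
  fix w show "w \<in> RL q \<longleftrightarrow> w \<in> RL r"
    using assms by (cases w) (simp_all add: Nil_in_RL Cons_in_RL)
qed

lemma RL_dead:
  assumes "q \<in> N" "g q = dead \<Sigma>"
  shows "RL q = {}"
proof -
  have "w \<notin> RL q" for w
    using assms by (cases w) (auto simp: Nil_in_RL Cons_in_RL dead_def)
  then show ?thesis by auto
qed

lemma wf_edges: "acyclic E \<Longrightarrow> wf (E\<inverse>)"
  using edges_subset fin by (intro finite_acyclic_wf_converse) (auto intro: finite_subset)

text \<open>
  In an acyclic automaton, a live state is accepting or has a transition to another state; since
  the path cannot go on forever, it ends in an accepting state.
\<close>

lemma RL_nonempty: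
  assumes ac: "acyclic E" and live: "\<And>q. q \<in> N \<Longrightarrow> g q \<noteq> dead \<Sigma>" and q: "q \<in> N"
  shows "RL q \<noteq> {}"
  using wf_edges[OF ac] q
proof (induction q rule: wf_induct_rule)
  case (less q)
  show ?case
  proof (cases "fst (g q)")
    case True
    then show ?thesis using Nil_in_RL[OF less.prems] by auto
  next
    case False
    have "\<exists>a\<in>\<Sigma>. snd (g q) a \<noteq> None"
    proof (rule ccontr)
      assume "\<not> ?thesis"
      then have "g q = dead \<Sigma>"
        using False less.prems dead_in_signatures
        by (intro signature_eqI) (auto simp: dead_def)
      then show False using live less.prems by simp
    qed
    then obtain a r where a: "a \<in> \<Sigma>" "snd (g q) a = Some r" by auto
    with less.prems have "r \<in> N" "(q, r) \<in> E" using edgeI target_in_states by auto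
    with less.IH obtain w where "w \<in> RL r" by blast
    then have "a # w \<in> RL q" using Cons_in_RL[OF less.prems] a by auto
    then show ?thesis by auto
  qed
qed

text \<open>
  Equal right languages force equal signatures.  Acceptance is the membership of the empty
  word.  As all right languages are nonempty, a letter leads to the absorbing state in one of the
  two states if and only if it does in the other; otherwise the two targets have equal right
  languages and coincide by induction along the transitions.
\<close>

lemma RL_inj:
  assumes ac: "acyclic E" and live: "\<And>q. q \<in> N \<Longrightarrow> g q \<noteq> dead \<Sigma>" and inj: "inj_on g N"
    and qr: "q \<in> N" "r \<in> N" "RL q = RL r"
  shows "q = r"
  using wf_edges[OF ac] qr
proof (induction q arbitrary: r rule: wf_induct_rule)
  case (less q)
  have "g q = g r"
  proof (rule signature_eqI)
    show "fst (g q) = fst (g r)" using less.prems Nil_in_RL by metis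
    fix a assume a: "a \<in> \<Sigma>"
    have ne: "\<exists>w. w \<in> RL s" if "p \<in> N" "snd (g p) a = Some s" for p s
      using RL_nonempty[OF ac live target_in_states[OF that(1) a that(2)]] by blast
    have iff: "(\<exists>s. snd (g q) a = Some s \<and> w \<in> RL s) \<longleftrightarrow> (\<exists>s. snd (g r) a = Some s \<and> w \<in> RL s)" for w
      using Cons_in_RL[OF less.prems(1), of a w] Cons_in_RL[OF less.prems(2), of a w]
        less.prems(3) a by simp
    show "snd (g q) a = snd (g r) a"
    proof (cases "snd (g q) a")
      case None
      have "snd (g r) a \<noteq> Some s" for s using None iff ne[OF less.prems(2), of s] by auto
      then show ?thesis using None by (cases "snd (g r) a") auto
    next
      case (Some s)
      then obtain s' where s': "snd (g r) a = Some s'" using iff ne[OF less.prems(1) Some] by auto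
      have "RL s = RL s'" using iff Some s' by auto
      then have "s = s'"
        using less.IH[of s s'] edgeI[OF less.prems(1) a Some]
          target_in_states[OF less.prems(1) a Some] target_in_states[OF less.prems(2) a s'] by simp
      then show ?thesis using Some s' by simp
    qed
  qed (use less.prems signature in auto)
  then show ?case using inj less.prems by (auto simp: inj_on_def)
qed

text \<open>
  In a finite acyclic graph, every nonempty set has a sink.  Conversely, the points on the cycles
  through a given point form a set without a sink.
\<close>

lemma acyclic_iff: "acyclic E \<longleftrightarrow> (\<forall>U\<subseteq>N. U \<noteq> {} \<longrightarrow> (\<exists>x\<in>U. E `` {x} \<subseteq> N - U))"
proof
  assume ac: "acyclic E"
  show "\<forall>U\<subseteq>N. U \<noteq> {} \<longrightarrow> (\<exists>x\<in>U. E `` {x} \<subseteq> N - U)"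
  proof (intro allI impI)
    fix U assume "U \<subseteq> N" "U \<noteq> {}"
    then obtain y where "y \<in> U" by auto
    then obtain x where "x \<in> U" "\<And>z. (z, x) \<in> E\<inverse> \<Longrightarrow> z \<notin> U"
      using wfE_min[OF wf_edges[OF ac]] by metis
    then show "\<exists>x\<in>U. E `` {x} \<subseteq> N - U" using edges_subset by (intro bexI[of _ x]) auto
  qed
next
  assume sink: "\<forall>U\<subseteq>N. U \<noteq> {} \<longrightarrow> (\<exists>x\<in>U. E `` {x} \<subseteq> N - U)"
  show "acyclic E"
    unfolding acyclic_def
  proof (intro allI notI)
    fix x assume x: "(x, x) \<in> E\<^sup>+"
    define U where "U = {y. (x, y) \<in> E\<^sup>+ \<and> (y, x) \<in> E\<^sup>+}"
    have "U \<subseteq> N"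
      using trancl_subset_Sigma[OF edges_subset] by (auto simp: U_def)
    moreover have "U \<noteq> {}" using x by (auto simp: U_def)
    ultimately obtain y where y: "y \<in> U" "E `` {y} \<subseteq> N - U" using sink by blast
    then have "(y, x) \<in> E\<^sup>+" by (simp add: U_def)
    then obtain z where z: "(y, z) \<in> E" "(z, x) \<in> E\<^sup>*" by (meson tranclD)
    have "(x, z) \<in> E\<^sup>+" using y(1) z(1) by (auto simp: U_def)
    moreover have "(z, x) \<in> E\<^sup>+" using z(2) x by (rule rtrancl_trancl_trancl)
    ultimately have "z \<in> U" by (simp add: U_def)
    then show False using y(2) z(1) by auto
  qed
qed

lemma acyclic_structures_iff:
  "g \<in> acyclic_structures \<Sigma> N \<longleftrightarrow> acyclic E \<and> inj_on g N \<and> (\<forall>q\<in>N. g q \<noteq> dead \<Sigma>)"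
proof
  assume gA: "g \<in> acyclic_structures \<Sigma> N"
  have "\<exists>x\<in>U. E `` {x} \<subseteq> N - U" if U: "U \<subseteq> N" "U \<noteq> {}" for U
  proof -
    obtain x where x: "x \<in> U" "g x \<in> signatures \<Sigma> (N - U)"
      using gA U unfolding acyclic_structures_def grounded_injections_def by blast
    then show ?thesis
      using signature_in_signatures_iff[of g x \<Sigma> N "N - U"] signature U by blast
  qed
  then show "acyclic E \<and> inj_on g N \<and> (\<forall>q\<in>N. g q \<noteq> dead \<Sigma>)"
    using gA acyclic_structuresD(2)[OF gA]
    by (auto simp: acyclic_iff acyclic_structures_def grounded_injections_def)
next
  assume R: "acyclic E \<and> inj_on g N \<and> (\<forall>q\<in>N. g q \<noteq> dead \<Sigma>)"
  have "\<exists>x\<in>U. g x \<in> signatures \<Sigma> (N - U) - {dead \<Sigma>}" if U: "U \<subseteq> N" "U \<noteq> {}" for U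
  proof -
    obtain x where x: "x \<in> U" "E `` {x} \<subseteq> N - U" using R U acyclic_iff by blast
    then show ?thesis
      using signature_in_signatures_iff[of g x \<Sigma> N "N - U"] signature U R by blast
  qed
  then show "g \<in> acyclic_structures \<Sigma> N"
    using R g by (simp add: acyclic_structures_def grounded_injections_def PiE_def)
qed

lemma is_dfa_automaton: "is_dfa \<Sigma> N (automaton \<Sigma> N i g)"
proof -
  have "snd (g q) a \<in> insert None (Some ` N)" if "q \<in> N" "a \<in> \<Sigma>" for q a
    using signature[OF that(1)] that(2) by (auto simp: signatures_def PiE_iff)
  then have "\<delta> \<in> N \<times> \<Sigma> \<rightarrow>\<^sub>E insert None (Some ` N)" by (intro PiE_I) (auto simp: transition_def)
  then show ?thesis using fin i by (auto simp: is_dfa_def automaton_def)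
qed

lemma automaton_in_madfas_iff:
  "automaton \<Sigma> N i g \<in> madfas \<Sigma> N i \<longleftrightarrow> g \<in> rooted_structures \<Sigma> N i"
proof -
  have "dfa_coreachable \<Sigma> N (automaton \<Sigma> N i g) \<and> dfa_simple \<Sigma> N (automaton \<Sigma> N i g) \<longleftrightarrow>
      inj_on g N \<and> (\<forall>q\<in>N. g q \<noteq> dead \<Sigma>)" if ac: "acyclic E"
  proof
    assume "dfa_coreachable \<Sigma> N (automaton \<Sigma> N i g) \<and> dfa_simple \<Sigma> N (automaton \<Sigma> N i g)"
    then show "inj_on g N \<and> (\<forall>q\<in>N. g q \<noteq> dead \<Sigma>)"
      unfolding dfa_coreachable_iff dfa_simple_def inj_on_def using RL_cong RL_dead by blast
  next
    assume R: "inj_on g N \<and> (\<forall>q\<in>N. g q \<noteq> dead \<Sigma>)"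
    show "dfa_coreachable \<Sigma> N (automaton \<Sigma> N i g) \<and> dfa_simple \<Sigma> N (automaton \<Sigma> N i g)"
      unfolding dfa_coreachable_iff dfa_simple_def
      using RL_nonempty[OF ac] RL_inj[OF ac] R by blast
  qed
  then show ?thesis
    using is_dfa_automaton dfa_acyclic_iff dfa_reachable_iff acyclic_structures_iff
    by (auto simp: madfas_def is_madfa_def dfa_minimal_def rooted_structures_def automaton_def)
qed

end

lemma acyclic_structures_subset: "acyclic_structures \<Sigma> N \<subseteq> N \<rightarrow>\<^sub>E signatures \<Sigma> N"
proof
  fix g assume g: "g \<in> acyclic_structures \<Sigma> N"
  then show "g \<in> N \<rightarrow>\<^sub>E signatures \<Sigma> N"
    using acyclic_structuresD(1)[OF g]
    by (auto simp: PiE_def acyclic_structures_def grounded_injections_def)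
qed

lemma bij_betw_automaton:
  assumes fin: "finite N" and i: "i \<in> N"
  shows "bij_betw (automaton \<Sigma> N i) (rooted_structures \<Sigma> N i) (madfas \<Sigma> N i)"
proof -
  have sub: "rooted_structures \<Sigma> N i \<subseteq> N \<rightarrow>\<^sub>E signatures \<Sigma> N"
    using acyclic_structures_subset[of \<Sigma> N] by (auto simp: rooted_structures_def)
  show ?thesis
    unfolding bij_betw_def
  proof
    show "inj_on (automaton \<Sigma> N i) (rooted_structures \<Sigma> N i)"
    proof (rule inj_onI)
      fix f g assume fg: "f \<in> rooted_structures \<Sigma> N i" "g \<in> rooted_structures \<Sigma> N i"
        and eq: "automaton \<Sigma> N i f = automaton \<Sigma> N i g"
      interpret f: signature_assignment \<Sigma> N i f using fg(1) sub fin i by unfold_locales auto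
      interpret g: signature_assignment \<Sigma> N i g using fg(2) sub fin i by unfold_locales auto
      show "f = g"
      proof (rule PiE_ext[OF f.g g.g])
        fix q assume q: "q \<in> N"
        have A: "{q \<in> N. fst (f q)} = {q \<in> N. fst (g q)}" and D: "f.\<delta> = g.\<delta>"
          using eq by (simp_all add: automaton_def)
        show "f q = g q"
        proof (rule f.signature_eqI[OF q g.signature[OF q]])
          show "fst (f q) = fst (g q)" using A q by blast
          show "snd (f q) a = snd (g q) a" if "a \<in> \<Sigma>" for a
            using fun_cong[OF D, of "(q, a)"] q that by simp
        qed
      qed
    qed
    show "automaton \<Sigma> N i ` rooted_structures \<Sigma> N i = madfas \<Sigma> N i"
    proof (intro equalityI subsetI)
      fix M assume "M \<in> automaton \<Sigma> N i ` rooted_structures \<Sigma> N i"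
      then obtain g where gR: "g \<in> rooted_structures \<Sigma> N i" and M: "M = automaton \<Sigma> N i g" by auto
      interpret signature_assignment \<Sigma> N i g using gR sub fin i by unfold_locales auto
      show "M \<in> madfas \<Sigma> N i" using automaton_in_madfas_iff gR M by simp
    next
      fix M assume M: "M \<in> madfas \<Sigma> N i"
      then obtain A \<delta> where M_eq: "M = (i, A, \<delta>)" and A: "A \<subseteq> N"
        and \<delta>: "\<delta> \<in> N \<times> \<Sigma> \<rightarrow>\<^sub>E insert None (Some ` N)"
        by (auto simp: madfas_def is_madfa_def is_dfa_def)
      define g where "g = (\<lambda>q\<in>N. (q \<in> A, \<lambda>a\<in>\<Sigma>. \<delta> (q, a)))"
      have "g \<in> N \<rightarrow>\<^sub>E signatures \<Sigma> N"
        unfolding g_def signatures_def using PiE_mem[OF \<delta>] by (intro PiE_I) auto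
      then interpret signature_assignment \<Sigma> N i g using fin i by unfold_locales auto
      have "transition \<Sigma> N g = \<delta>"
        using \<delta> by (intro extensionalityI[of _ "N \<times> \<Sigma>"]) (auto simp: transition_def g_def PiE_iff)
      moreover have "{q \<in> N. fst (g q)} = A" using A by (auto simp: g_def)
      ultimately have "automaton \<Sigma> N i g = M" by (simp add: automaton_def M_eq)
      then show "M \<in> automaton \<Sigma> N i ` rooted_structures \<Sigma> N i"
        using M automaton_in_madfas_iff by blast
    qed
  qed
qed

section \<open>The recurrence\<close>

lemma finite_acyclic_structures:
  assumes "finite \<Sigma>" "finite N"
  shows "finite (acyclic_structures \<Sigma> N)"
  using acyclic_structures_subset
  by (rule finite_subset) (intro finite_PiE finite_signatures assms)

lemma card_acyclic_structures:
  assumes "finite \<Sigma>" "finite N"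
  shows "card (acyclic_structures \<Sigma> N) = num_simple_parking (\<lambda>m. 2 * m ^ card \<Sigma> - 1) (card N)"
  using card_grounded_signatures[of \<Sigma> N "{}" "{dead \<Sigma>}" 0] assms
  by (simp add: acyclic_structures_def dead_in_signatures)

lemma card_structures_with_reachable_set_eq:
  fixes N :: "'q set" and \<Sigma> :: "'a set"
  assumes fin: "finite \<Sigma>" "finite N" and T: "T \<subseteq> N" "i \<in> T"
  shows "card {g \<in> acyclic_structures \<Sigma> N. (edges \<Sigma> N g)\<^sup>* `` {i} = T} =
    num_simple_parking (\<lambda>m. 2 * (m + card T) ^ card \<Sigma> - card T - 1) (card N - card T) *
    num_madfa (card \<Sigma>) (card T)"
proof -
  have finT: "finite T" using T(1) fin(2) finite_subset by auto
  let ?G = "\<lambda>h. grounded_injections (\<lambda>V. signatures \<Sigma> (T \<union> V) - insert (dead \<Sigma>) (h ` T)) (N - T)"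
  have "finite (rooted_structures \<Sigma> T i)"
    using finite_acyclic_structures[OF fin(1) finT] by (simp add: rooted_structures_def)
  moreover have "finite (?G h)" for h
  proof (rule finite_grounded_injections)
    show "signatures \<Sigma> (T \<union> V) - insert (dead \<Sigma>) (h ` T) \<subseteq>
        signatures \<Sigma> (T \<union> W) - insert (dead \<Sigma>) (h ` T)" if "V \<subseteq> W" for V W
      using signatures_mono[of "T \<union> V" "T \<union> W" \<Sigma>] that by blast
  qed (use fin finT in \<open>simp_all add: finite_signatures\<close>)
  moreover have "card (?G h) =
      num_simple_parking (\<lambda>m. 2 * (m + card T) ^ card \<Sigma> - card T - 1) (card N - card T)"
    if "h \<in> rooted_structures \<Sigma> T i" for h
  proof -
    have h: "h \<in> acyclic_structures \<Sigma> T" using that by (simp add: rooted_structures_def)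
    then have "inj_on h T" by (simp add: acyclic_structures_def grounded_injections_def)
    moreover have "dead \<Sigma> \<notin> h ` T" using acyclic_structuresD(2)[OF h] by (metis imageE)
    ultimately have "card (insert (dead \<Sigma>) (h ` T)) = card T + 1"
      using finT by (simp add: card_image)
    moreover have "insert (dead \<Sigma>) (h ` T) \<subseteq> signatures \<Sigma> T"
      using acyclic_structuresD(1)[OF h] dead_in_signatures by auto
    ultimately have "card (?G h) =
        num_simple_parking (\<lambda>m. 2 * (m + card T) ^ card \<Sigma> - card T - 1) (card (N - T))"
      using fin finT by (intro card_grounded_signatures) auto
    then show ?thesis using finT T(1) by (simp add: card_Diff_subset)
  qed
  moreover have "card (rooted_structures \<Sigma> T i) = num_madfa (card \<Sigma>) (card T)"
    using bij_betw_same_card[OF bij_betw_automaton[OF finT T(2), of \<Sigma>]]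
      card_madfas[OF fin(1) finT T(2)] by simp
  ultimately show ?thesis
    by (simp add: card_structures_with_reachable_set[OF T] card_SigmaI)
qed

lemma card_subsets_containing:
  assumes "finite N" "i \<in> N" "t \<ge> 1"
  shows "card {T. T \<subseteq> N \<and> i \<in> T \<and> card T = t} = (card N - 1) choose (t - 1)"
proof -
  have "card {T. T \<subseteq> N \<and> i \<in> T \<and> card T = t} = card {B. B \<subseteq> N - {i} \<and> card B = t - 1}"
  proof (rule bij_betw_same_card)
    show "bij_betw (\<lambda>T. T - {i}) {T. T \<subseteq> N \<and> i \<in> T \<and> card T = t}
        {B. B \<subseteq> N - {i} \<and> card B = t - 1}"
    proof (rule bij_betw_byWitness[where f' = "insert i"])
      show "insert i ` {B. B \<subseteq> N - {i} \<and> card B = t - 1} \<subseteq> {T. T \<subseteq> N \<and> i \<in> T \<and> card T = t}"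
      proof
        fix T assume "T \<in> insert i ` {B. B \<subseteq> N - {i} \<and> card B = t - 1}"
        then obtain B where B: "T = insert i B" "B \<subseteq> N - {i}" "card B = t - 1" by auto
        then have "finite B" "i \<notin> B" using assms(1) finite_subset by auto
        then show "T \<in> {T. T \<subseteq> N \<and> i \<in> T \<and> card T = t}" using B assms by auto
      qed
    qed auto
  qed
  also have "\<dots> = (card N - 1) choose (t - 1)"
    using assms by (simp add: n_subsets)
  finally show ?thesis .
qed

lemma num_simple_parking_recurrence:
  assumes n: "n \<ge> 1"
  shows "num_simple_parking (\<lambda>m. 2 * m ^ k - 1) n =
    (\<Sum>t=1..n. ((n - 1) choose (t - 1)) *
      num_simple_parking (\<lambda>m. 2 * (m + t) ^ k - t - 1) (n - t) * num_madfa k t)"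
proof -
  define N :: "nat set" where "N = {1..n}"
  define \<Sigma> :: "nat set" where "\<Sigma> = {1..k}"
  have N: "finite N" "card N = n" "1 \<in> N" and \<Sigma>: "finite \<Sigma>" "card \<Sigma> = k"
    using n by (auto simp: N_def \<Sigma>_def)
  define reach where "reach g = (edges \<Sigma> N g)\<^sup>* `` {1}" for g
  define \<T> where "\<T> = {T. T \<subseteq> N \<and> 1 \<in> T}"
  let ?f = "\<lambda>t. num_simple_parking (\<lambda>m. 2 * (m + t) ^ k - t - 1) (n - t) * num_madfa k t"
  have fin\<T>: "finite \<T>" using N(1) by (simp add: \<T>_def)
  have reach: "reach g \<in> \<T>" if "g \<in> acyclic_structures \<Sigma> N" for g
  proof -
    have "edges \<Sigma> N g `` N \<subseteq> N" using acyclic_structuresD(1)[OF that] by (rule edges_into)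
    then show ?thesis using reachable_subset[OF _ N(3)] by (auto simp: reach_def \<T>_def)
  qed
  have "card (acyclic_structures \<Sigma> N) =
      (\<Sum>T\<in>\<T>. card {g \<in> acyclic_structures \<Sigma> N. reach g = T})"
    unfolding card_eq_sum
    by (rule sum.group[symmetric]) (use finite_acyclic_structures[OF \<Sigma>(1) N(1)] fin\<T> reach in auto)
  also have "\<dots> = (\<Sum>T\<in>\<T>. ?f (card T))"
    using card_structures_with_reachable_set_eq[OF \<Sigma>(1) N(1), of _ 1] N(2) \<Sigma>(2)
    by (intro sum.cong) (auto simp: \<T>_def reach_def)
  also have "\<dots> = (\<Sum>t=1..n. \<Sum>T\<in>{T \<in> \<T>. card T = t}. ?f (card T))"
  proof (rule sum.group[symmetric])
    have "card T \<in> {1..n}" if "T \<in> \<T>" for T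
    proof -
      have "T \<subseteq> N" "1 \<in> T" "finite T"
        using that N(1) by (auto simp: \<T>_def intro: finite_subset)
      then show ?thesis
        using card_mono[OF N(1), of T] N(2) by (auto simp: Suc_le_eq card_gt_0_iff)
    qed
    then show "card ` \<T> \<subseteq> {1..n}" by blast
  qed (use fin\<T> in auto)
  also have "\<dots> = (\<Sum>t=1..n. ((n - 1) choose (t - 1)) * ?f t)"
  proof (rule sum.cong[OF refl])
    fix t assume "t \<in> {1..n}"
    then have "card {T \<in> \<T>. card T = t} = (n - 1) choose (t - 1)"
      using card_subsets_containing[OF N(1,3), of t] N(2) by (simp add: \<T>_def conj_assoc)
    then show "(\<Sum>T\<in>{T \<in> \<T>. card T = t}. ?f (card T)) = ((n - 1) choose (t - 1)) * ?f t"
      by simp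
  qed
  finally show ?thesis
    using card_acyclic_structures[OF \<Sigma>(1) N(1)] N(2) \<Sigma>(2) by (simp add: mult.assoc)
qed

lemma num_simple_parking_0: "num_simple_parking \<chi> 0 = 1"
  by (simp add: num_simple_parking_def simple_parking_functions_def parking_functions_def)

lemma num_simple_parking_1:
  assumes "\<chi> 1 = 1"
  shows "num_simple_parking \<chi> 1 = 1"
proof -
  have "simple_parking_functions \<chi> {1::nat} = {\<lambda>x\<in>{1}. 1}"
  proof (intro equalityI subsetI)
    fix f :: "nat \<Rightarrow> nat" assume "f \<in> simple_parking_functions \<chi> {1}"
    then have f: "f \<in> extensional {1}" and "1 \<le> card {x \<in> {1}. f x \<in> {1..\<chi> 1}}"
      by (auto simp: simple_parking_functions_def parking_functions_def PiE_def)
    then have "{x \<in> {1}. f x \<in> {1..\<chi> 1}} \<noteq> {}" by (metis card.empty not_one_le_zero)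
    then have "f 1 = 1" using assms by auto
    then show "f \<in> {\<lambda>x\<in>{1}. 1}" using f by (auto simp: extensional_def fun_eq_iff)
  next
    fix f :: "nat \<Rightarrow> nat" assume "f \<in> {\<lambda>x\<in>{1}. 1}"
    moreover have "{x::nat. x = 1 \<and> P} = (if P then {1} else {})" for P by auto
    ultimately show "f \<in> simple_parking_functions \<chi> {1}"
      using assms
      by (auto simp: simple_parking_functions_def parking_functions_def card_le_Suc0_iff_eq)
  qed
  then show ?thesis by (simp add: num_simple_parking_def)
qed

text \<open>
  The value of \<open>num_madfa k 1\<close> is read off from the recurrence for \<open>n = 1\<close>, whose only summand has
  \<open>t = 1\<close>.
\<close>

theorem theorem4:
  fixes k :: nat
  assumes "k \<ge> 1"
  shows "num_madfa k 1 = 1 \<and>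
    (\<forall>n\<ge>1. num_simple_parking (\<lambda>m. 2 * m ^ k - 1) n =
      (\<Sum>t=1..n. ((n - 1) choose (t - 1)) *
        num_simple_parking (\<lambda>m. 2 * (m + t) ^ k - t - 1) (n - t) * num_madfa k t))"
proof
  show "num_madfa k 1 = 1"
    using num_simple_parking_recurrence[of 1 k]
      num_simple_parking_1[of "\<lambda>m. 2 * m ^ k - 1"]
    by (simp add: num_simple_parking_0)
qed (use num_simple_parking_recurrence in blast)

end
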